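(* For every positive integer $k$, $\ \mathbf I_k(n)=\mathbf S_{(k)}(n)$, where $(k)$ is the row shape of length $k$.
   Context: Virtual symbols. Let $\mathcal L=\{1,\dots,n\}$, and let $\mathcal A_0=\{\alpha_1,\dots,\alpha_{m_0}\}$, $\mathcal A_1=\{\beta_1,\dots,\beta_{m_1}\}$ be finite sets of auxiliary (virtual) symbols, with $m_0,m_1$ sufficiently large. Put $|a|=0\in\mathbb Z_2$ for $a\in\mathcal A_0$ and $|a|=1\in\mathbb Z_2$ for $a\in\mathcal A_1\cup\mathcal L$. Let $gl(m_0|m_1+n)$ be the complex Lie superalgebra with basis $e_{a,b}$, $a,b\in\mathcal A_0\cup\mathcal A_1\cup\mathcal L$, $|e_{a,b}|=|a|+|b|$, and superbracket $[e_{a,b},e_{c,d}]=\delta_{bc}e_{a,d}-(-1)^{(|a|+|b|)(|c|+|d|)}\delta_{ad}e_{c,b}$. Its enveloping superalgebra $\mathbf U(gl(m_0|m_1+n))$ contains $\mathbf U(gl(n))$ as the subalgebra generated by $e_{i,j}$, $i,j\in\mathcal L$. Devirtualization. A product $e_{a_m,b_m}\cdots e_{a_1,b_1}$ is irregular if there are $i\le m$ and a virtual symbol $\gamma\in\mathcal A_0\cup\mathcal A_1$ with $\#\{j\le i: b_j=\gamma\}>\#\{j<i: a_j=\gamma\}$. Let $\mathbf{Irr}$ be the left ideal of $\mathbf U(gl(m_0|m_1+n))$ generated by the irregular products. The sum $Virt=\mathbf U(gl(n))+\mathbf{Irr}$ is direct and is a subalgebra, in which $\mathbf{Irr}$ is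 a two-sided ideal; $\mathfrak p:Virt\to\mathbf U(gl(n))$ denotes the projection with kernel $\mathbf{Irr}$ (an algebra epimorphism). Tableaux. A Young tableau of shape $\lambda$ over an alphabet is any filling of the cells of the Ferrers diagram of $\lambda$ (rows of lengths $\lambda_1\ge\lambda_2\ge\cdots$). For tableaux $S,T$ of the same shape, $e_{S,T}$ is the product of the $e_{S(c),T(c)}$ over the cells $c$, read row by row from top to bottom, left to right in each row. $D^*_\lambda$ is the tableau of shape $\lambda$ whose $r$-th row is $\beta_1\beta_2\cdots\beta_{\lambda_r}$, and $C^*_\lambda$ the tableau of shape $\lambda$ whose $r$-th row is $\alpha_r\alpha_r\cdots\alpha_r$ (the $\alpha$'s and $\beta$'s being arbitrary distinct positive, resp. negative, virtual symbols). For tableaux $S,T$ of shape $\lambda$ over $\mathcal L$, the double Young-Capelli bitableau is $[\,\boxed{S\,|\,T}\,]=\mathfrak p\big(e_{S,C^*_\lambda}e_{C^*_\lambda,D^*_\lambda}e_{D^*_\lambda,C^*_\lambda}e_{C^*_\lambda,T}\big)\in\mathbf U(gl(n))$; the argument of $\mathfrak p$ lies in $Virt$ and the result does not depend on the choice of virtual symbols. Schur elements. $\widetilde\lambda$ is the conjugate partition and $H(\lambda)=H(\widetilde\lambda)$ the product of the hook lengths of all boxes of the Ferrers diagram. For $\widetilde\lambda_1\le n$, $\mathbf S_\lambda(n)=\frac1{H(\widetilde\lambda)}\sum_S[\,\boxed{S\,|\,S}\,]$, the sum over all tableaux $S$ of shape $\widetilde\lambda$ on $\mathcal L$ with strictly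 increasing rows (no condition on columns). Nazarov elements. For $\beta\in\mathcal A_1$ and $k\in\mathbb Z^+$, $\mathbf I_k(n)=\sum_{h_1+\cdots+h_n=k}\frac1{h_1!\cdots h_n!}\,\mathfrak p\big(e_{n,\beta}^{h_n}\cdots e_{2,\beta}^{h_2}e_{1,\beta}^{h_1}\,e_{\beta,1}^{h_1}e_{\beta,2}^{h_2}\cdots e_{\beta,n}^{h_n}\big)\in\mathbf U(gl(n))$, the sum over all $n$-tuples of nonnegative integers with sum $k$. *)

theory Defs
  imports Complex_Main "HOL-Library.Poly_Mapping"
begin

section \<open>Free associative algebras\<close>

datatype 'a word = Word (letters: "'a list")

instantiation word :: (type) monoid_add
begin

definition zero_word :: "'a word" where
  "zero_word = Word []"

definition plus_word :: "'a word \<Rightarrow> 'a word \<Rightarrow> 'a word" where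
  "plus_word u v = Word (letters u @ letters v)"

instance
  by standard (auto simp: zero_word_def plus_word_def)

end

text \<open>The free monoid is written additively so that the convolution product of
  \<open>HOL-Library.Poly_Mapping\<close> turns \<open>'a word \<Rightarrow>\<^sub>0 complex\<close> into the free associative unital
  complex algebra on \<open>'a\<close>.\<close>

type_synonym 'a free_alg = "'a word \<Rightarrow>\<^sub>0 complex"

abbreviation gen :: "'a \<Rightarrow> 'a free_alg" where
  "gen x \<equiv> Poly_Mapping.single (Word [x]) 1"

abbreviation const :: "complex \<Rightarrow> 'a free_alg" where
  "const c \<equiv> Poly_Mapping.single 0 c"

lemma plus_word_eq_0_iff: "u + v = 0 \<longleftrightarrow> u = 0 \<and> v = (0 :: 'a word)"
  by (cases u; cases v) (simp add: zero_word_def plus_word_def)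

lemma lookup_times_0:
  fixes f g :: "'a free_alg"
  shows "Poly_Mapping.lookup (f * g) 0 = Poly_Mapping.lookup f 0 * Poly_Mapping.lookup g 0"
proof -
  have "(Poly_Mapping.lookup g q when (0 :: 'a word) = l + q) =
      ((Poly_Mapping.lookup g q when l = 0) when q = 0)" for l q :: "'a word"
    using plus_word_eq_0_iff[of l q] by (auto simp: when_def)
  then have "Poly_Mapping.lookup (f * g) 0 =
      Sum_any (\<lambda>l. Poly_Mapping.lookup f l *
        Sum_any (\<lambda>q. (Poly_Mapping.lookup g q when l = 0) when q = 0))"
    by (simp add: lookup_mult)
  also have "\<dots> = Sum_any (\<lambda>l. (Poly_Mapping.lookup f l * Poly_Mapping.lookup g 0) when l = 0)"
    by (simp add: mult_when)
  finally show ?thesis by simp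
qed


section \<open>The enveloping superalgebra of the general linear Lie superalgebra\<close>

text \<open>The alphabet: \<open>'p\<close> indexes the positive virtual symbols \<open>\<alpha>\<^sub>1, \<dots>, \<alpha>\<^bsub>m\<^sub>0\<^esub>\<close>, \<open>'q\<close> the negative
  virtual symbols \<open>\<beta>\<^sub>1, \<dots>, \<beta>\<^bsub>m\<^sub>1\<^esub>\<close>, and \<open>'n\<close>, a finite linear order, the proper
  symbols \<open>\<L> = {1, \<dots>, n}\<close>.\<close>

datatype ('p, 'q, 'n) symb = Pos 'p | Neg 'q | Prop 'n

fun is_virtual :: "('p, 'q, 'n) symb \<Rightarrow> bool" where
  "is_virtual (Pos _) = True"
| "is_virtual (Neg _) = True"
| "is_virtual (Prop _) = False"

text \<open>Degrees in \<open>\<int>\<^sub>2\<close> are represented by natural numbers; they occur only as exponents of \<open>-1\<close>.\<close>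

fun par :: "('p, 'q, 'n) symb \<Rightarrow> nat" where
  "par (Pos _) = 0"
| "par (Neg _) = 1"
| "par (Prop _) = 1"

type_synonym ('p, 'q, 'n) unit_symb = "('p, 'q, 'n) symb \<times> ('p, 'q, 'n) symb"

definition koszul_sign :: "('p, 'q, 'n) unit_symb \<Rightarrow> ('p, 'q, 'n) unit_symb \<Rightarrow> complex" where
  "koszul_sign x y = (- 1) ^ ((par (fst x) + par (snd x)) * (par (fst y) + par (snd y)))"

text \<open>The superbracket of two basis elements \<open>e\<^bsub>a,b\<^esub>\<close>, \<open>e\<^bsub>c,d\<^esub>\<close>, as an element of the tensor algebra of
  \<open>gl(m\<^sub>0|m\<^sub>1+n)\<close>, i.e. of the free algebra on the basis.\<close>

definition gl_bracket :: "('p, 'q, 'n) unit_symb \<Rightarrow> ('p, 'q, 'n) unit_symb \<Rightarrow>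
    ('p, 'q, 'n) unit_symb free_alg" where
  "gl_bracket x y = (case x of (a, b) \<Rightarrow> case y of (c, d) \<Rightarrow>
     (if b = c then gen (a, d) else 0)
     - const (koszul_sign (a, b) (c, d)) * (if a = d then gen (c, b) else 0))"

definition gl_relator :: "('p, 'q, 'n) unit_symb \<Rightarrow> ('p, 'q, 'n) unit_symb \<Rightarrow>
    ('p, 'q, 'n) unit_symb free_alg" where
  "gl_relator x y = gen x * gen y - const (koszul_sign x y) * (gen y * gen x) - gl_bracket x y"

inductive_set gl_ideal :: "('p, 'q, 'n) unit_symb free_alg set" where
  zero: "0 \<in> gl_ideal"
| relator: "u * gl_relator x y * v \<in> gl_ideal"
| add: "f \<in> gl_ideal \<Longrightarrow> g \<in> gl_ideal \<Longrightarrow> f + g \<in> gl_ideal"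

lemma gl_ideal_mult_left: "f \<in> gl_ideal \<Longrightarrow> w * f \<in> gl_ideal"
proof (induction rule: gl_ideal.induct)
  case (relator u x y v)
  then show ?case using gl_ideal.relator[of "w * u" x y v] by (simp add: mult.assoc)
qed (auto intro: gl_ideal.intros simp: distrib_left)

lemma gl_ideal_mult_right: "f \<in> gl_ideal \<Longrightarrow> f * w \<in> gl_ideal"
proof (induction rule: gl_ideal.induct)
  case (relator u x y v)
  then show ?case using gl_ideal.relator[of u x y "v * w"] by (simp add: mult.assoc)
qed (auto intro: gl_ideal.intros simp: distrib_right)

lemma gl_ideal_uminus: "f \<in> gl_ideal \<Longrightarrow> - f \<in> gl_ideal"
  using gl_ideal_mult_left[of f "- 1"] by simp

lemma gl_ideal_diff: "f \<in> gl_ideal \<Longrightarrow> g \<in> gl_ideal \<Longrightarrow> f - g \<in> gl_ideal"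
  using gl_ideal.add[of f "- g"] gl_ideal_uminus[of g] by simp

lemma lookup_gen_0: "Poly_Mapping.lookup (gen x) 0 = 0"
  by (simp add: lookup_single zero_word_def)

lemma gl_ideal_lookup_0: "f \<in> gl_ideal \<Longrightarrow> Poly_Mapping.lookup f 0 = 0"
proof (induction rule: gl_ideal.induct)
  case (relator u x y v)
  have "Poly_Mapping.lookup (gl_relator x y) 0 = 0"
    by (cases x; cases y) (simp add: gl_relator_def gl_bracket_def lookup_minus lookup_times_0 lookup_gen_0)
  then show ?case by (simp add: lookup_times_0)
qed (auto simp: lookup_add)

definition gl_rel :: "('p, 'q, 'n) unit_symb free_alg \<Rightarrow> ('p, 'q, 'n) unit_symb free_alg \<Rightarrow> bool" where
  "gl_rel f g \<longleftrightarrow> f - g \<in> gl_ideal"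

lemma equivp_gl_rel: "equivp gl_rel"
proof (rule equivpI)
  show "reflp gl_rel" by (auto simp: reflp_def gl_rel_def intro: gl_ideal.zero)
  show "symp gl_rel" using gl_ideal_uminus by (fastforce simp: symp_def gl_rel_def)
  show "transp gl_rel" using gl_ideal.add by (fastforce simp: transp_def gl_rel_def)
qed

text \<open>\<open>('p, 'q, 'n) ugl\<close> is \<open>\<^bold>U(gl(m\<^sub>0|m\<^sub>1+n))\<close> for \<open>m\<^sub>0 = CARD('p)\<close>, \<open>m\<^sub>1 = CARD('q)\<close>, \<open>n = CARD('n)\<close>.\<close>

quotient_type ('p, 'q, 'n) ugl = "('p, 'q, 'n) unit_symb free_alg" / gl_rel
  by (rule equivp_gl_rel)

instantiation ugl :: (type, type, type) ring_1
begin

lift_definition zero_ugl :: "('a, 'b, 'c) ugl" is 0 .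

lift_definition one_ugl :: "('a, 'b, 'c) ugl" is 1 .

lift_definition plus_ugl :: "('a, 'b, 'c) ugl \<Rightarrow> ('a, 'b, 'c) ugl \<Rightarrow> ('a, 'b, 'c) ugl" is "(+)"
  unfolding gl_rel_def
proof -
  fix f f' g g' :: "('a, 'b, 'c) unit_symb free_alg"
  assume "f - f' \<in> gl_ideal" "g - g' \<in> gl_ideal"
  from gl_ideal.add[OF this] show "f + g - (f' + g') \<in> gl_ideal"
    by (simp add: algebra_simps)
qed

lift_definition uminus_ugl :: "('a, 'b, 'c) ugl \<Rightarrow> ('a, 'b, 'c) ugl" is uminus
  unfolding gl_rel_def
proof -
  fix f f' :: "('a, 'b, 'c) unit_symb free_alg"
  assume "f - f' \<in> gl_ideal"
  from gl_ideal_uminus[OF this] show "- f - - f' \<in> gl_ideal"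
    by simp
qed

lift_definition minus_ugl :: "('a, 'b, 'c) ugl \<Rightarrow> ('a, 'b, 'c) ugl \<Rightarrow> ('a, 'b, 'c) ugl" is "(-)"
  unfolding gl_rel_def
proof -
  fix f f' g g' :: "('a, 'b, 'c) unit_symb free_alg"
  assume "f - f' \<in> gl_ideal" "g - g' \<in> gl_ideal"
  from gl_ideal_diff[OF this] show "f - g - (f' - g') \<in> gl_ideal"
    by (simp add: algebra_simps)
qed

lift_definition times_ugl :: "('a, 'b, 'c) ugl \<Rightarrow> ('a, 'b, 'c) ugl \<Rightarrow> ('a, 'b, 'c) ugl" is "(*)"
  unfolding gl_rel_def
proof -
  fix f f' g g' :: "('a, 'b, 'c) unit_symb free_alg"
  assume *: "f - f' \<in> gl_ideal" "g - g' \<in> gl_ideal"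
  have "f * g - f' * g' = (f - f') * g + f' * (g - g')"
    by (simp add: algebra_simps)
  with * show "f * g - f' * g' \<in> gl_ideal"
    by (simp add: gl_ideal.add gl_ideal_mult_left gl_ideal_mult_right)
qed

instance
proof
  show "(0 :: ('a, 'b, 'c) ugl) \<noteq> 1"
  proof
    assume "(0 :: ('a, 'b, 'c) ugl) = 1"
    then have "(1 :: ('a, 'b, 'c) unit_symb free_alg) - 0 \<in> gl_ideal"
      unfolding zero_ugl_def one_ugl_def ugl.abs_eq_iff gl_rel_def
      using gl_ideal_uminus by fastforce
    from gl_ideal_lookup_0[OF this] show False by (simp add: lookup_one)
  qed
qed (transfer; simp add: gl_rel_def algebra_simps gl_ideal.zero)+

end

lift_definition e :: "('p, 'q, 'n) symb \<Rightarrow> ('p, 'q, 'n) symb \<Rightarrow> ('p, 'q, 'n) ugl" is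
  "\<lambda>a b. gen (a, b)" .

text \<open>The structure map \<open>c \<mapsto> c \<cdot> 1\<close> of the complex algebra \<open>ugl\<close>.\<close>

lift_definition scal :: "complex \<Rightarrow> ('p, 'q, 'n) ugl" is const .

lemma e_supercommute:
  "e a b * e c d - scal ((- 1) ^ ((par a + par b) * (par c + par d))) * (e c d * e a b) =
     (if b = c then e a d else 0)
     - scal ((- 1) ^ ((par a + par b) * (par c + par d))) * (if a = d then e c b else 0)"
proof -
  define s where "s = koszul_sign (a, b) (c, d)"
  have "gl_relator (a, b) (c, d) \<in> gl_ideal"
    using gl_ideal.relator[of 1 "(a, b)" "(c, d)" 1] by simp
  then have "abs_ugl (gen (a, b) * gen (c, d) - const s * (gen (c, d) * gen (a, b))) =
      abs_ugl ((if b = c then gen (a, d) else 0) - const s * (if a = d then gen (c, b) else 0))"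
    by (simp only: ugl.abs_eq_iff gl_rel_def gl_relator_def gl_bracket_def s_def prod.case)
  then have "e a b * e c d - scal s * (e c d * e a b) =
      (if b = c then e a d else 0) - scal s * (if a = d then e c b else 0)"
    unfolding e.abs_eq scal.abs_eq zero_ugl.abs_eq times_ugl.abs_eq minus_ugl.abs_eq
      if_distrib[of abs_ugl, symmetric] .
  then show ?thesis by (simp only: s_def koszul_sign_def fst_conv snd_conv)
qed


section \<open>Devirtualization\<close>

text \<open>\<open>\<^bold>U(gl(n))\<close> inside \<open>\<^bold>U(gl(m\<^sub>0|m\<^sub>1+n))\<close>.\<close>

inductive_set Ugln :: "('p, 'q, 'n) ugl set" where
  scal: "scal c \<in> Ugln"
| e: "e (Prop i) (Prop j) \<in> Ugln"
| add: "x \<in> Ugln \<Longrightarrow> y \<in> Ugln \<Longrightarrow> x + y \<in> Ugln"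
| mult: "x \<in> Ugln \<Longrightarrow> y \<in> Ugln \<Longrightarrow> x * y \<in> Ugln"

definition e_prod :: "('p, 'q, 'n) unit_symb list \<Rightarrow> ('p, 'q, 'n) ugl" where
  "e_prod w = prod_list (map (\<lambda>(a, b). e a b) w)"

text \<open>The factors of \<open>e\<^bsub>a\<^sub>m,b\<^sub>m\<^esub> \<cdots> e\<^bsub>a\<^sub>1,b\<^sub>1\<^esub>\<close> are numbered from right to left, hence the reversal:
  \<open>rev w ! (j - 1) = (a\<^sub>j, b\<^sub>j)\<close>.\<close>

definition irregular :: "('p, 'q, 'n) unit_symb list \<Rightarrow> bool" where
  "irregular w \<longleftrightarrow> (\<exists>i < length w. \<exists>\<gamma>. is_virtual \<gamma> \<and>
     card {j. j \<le> i \<and> snd (rev w ! j) = \<gamma>} > card {j. j < i \<and> fst (rev w ! j) = \<gamma>})"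

inductive_set Irr :: "('p, 'q, 'n) ugl set" where
  zero: "0 \<in> Irr"
| mult: "irregular w \<Longrightarrow> x * e_prod w \<in> Irr"
| add: "x \<in> Irr \<Longrightarrow> y \<in> Irr \<Longrightarrow> x + y \<in> Irr"

text \<open>The projection \<open>\<pp>\<close> of the direct sum \<open>Virt = \<^bold>U(gl(n)) \<oplus> \<^bold>I\<^bold>r\<^bold>r\<close> onto \<open>\<^bold>U(gl(n))\<close>; it is
  meaningful only on \<open>Virt\<close>.\<close>

definition devirt :: "('p, 'q, 'n) ugl \<Rightarrow> ('p, 'q, 'n) ugl" where
  "devirt x = (THE u. u \<in> Ugln \<and> x - u \<in> Irr)"


section \<open>Partitions and tableaux\<close>

text \<open>Partitions are weakly decreasing lists of positive numbers; tableaux are lists of rows.\<close>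

fun first_part :: "nat list \<Rightarrow> nat" where
  "first_part [] = 0"
| "first_part (r # _) = r"

definition conj_part :: "nat list \<Rightarrow> nat list" where
  "conj_part lam = map (\<lambda>j. length (filter (\<lambda>r. j \<le> r) lam)) [1..<Suc (first_part lam)]"

text \<open>Rows and columns of boxes are numbered from \<open>0\<close>; a hook consists of the arm, the leg and the
  box itself.\<close>

definition hook_length :: "nat list \<Rightarrow> nat \<Rightarrow> nat \<Rightarrow> nat" where
  "hook_length lam i j = (lam ! i - Suc j) + (conj_part lam ! j - Suc i) + 1"

definition hook_prod :: "nat list \<Rightarrow> nat" where
  "hook_prod lam = (\<Prod>i<length lam. \<Prod>j<lam ! i. hook_length lam i j)"

type_synonym 'a tableau = "'a list list"

definition has_shape :: "'a tableau \<Rightarrow> nat list \<Rightarrow> bool" where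
  "has_shape S lam \<longleftrightarrow> map length S = lam"

definition e_tab :: "('p, 'q, 'n) symb tableau \<Rightarrow> ('p, 'q, 'n) symb tableau \<Rightarrow> ('p, 'q, 'n) ugl" where
  "e_tab S T = e_prod (zip (concat S) (concat T))"

text \<open>The families \<open>\<alpha>\<close>, \<open>\<beta>\<close> of virtual symbols are indexed from \<open>1\<close>.\<close>

definition C_star :: "(nat \<Rightarrow> 'p) \<Rightarrow> nat list \<Rightarrow> ('p, 'q, 'n) symb tableau" where
  "C_star \<alpha> lam = map (\<lambda>r. replicate (lam ! r) (Pos (\<alpha> (Suc r)))) [0..<length lam]"

definition D_star :: "(nat \<Rightarrow> 'q) \<Rightarrow> nat list \<Rightarrow> ('p, 'q, 'n) symb tableau" where
  "D_star \<beta> lam = map (\<lambda>r. map (\<lambda>c. Neg (\<beta> c)) [1..<Suc r]) lam"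

definition distinct_symbols :: "nat list \<Rightarrow> (nat \<Rightarrow> 'p) \<Rightarrow> (nat \<Rightarrow> 'q) \<Rightarrow> bool" where
  "distinct_symbols lam \<alpha> \<beta> \<longleftrightarrow> inj_on \<alpha> {1..length lam} \<and> inj_on \<beta> {1..first_part lam}"

definition double_young_capelli ::
  "(nat \<Rightarrow> 'p) \<Rightarrow> (nat \<Rightarrow> 'q) \<Rightarrow> nat list \<Rightarrow> 'n tableau \<Rightarrow> 'n tableau \<Rightarrow> ('p, 'q, 'n) ugl" where
  "double_young_capelli \<alpha> \<beta> lam S T =
     devirt (e_tab (map (map Prop) S) (C_star \<alpha> lam) * e_tab (C_star \<alpha> lam) (D_star \<beta> lam)
       * e_tab (D_star \<beta> lam) (C_star \<alpha> lam) * e_tab (C_star \<alpha> lam) (map (map Prop) T))"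


section \<open>Schur and Nazarov elements\<close>

text \<open>\<open>\<^bold>S\<^sub>\<lambda>(n)\<close>, computed with the virtual symbols \<open>\<alpha>\<close>, \<open>\<beta>\<close>; these must satisfy
  \<open>distinct_symbols (conj_part lam) \<alpha> \<beta>\<close>, and \<open>conj_part lam\<close> must have first row of length at most \<open>n\<close>.\<close>

definition schur_elt ::
  "(nat \<Rightarrow> 'p) \<Rightarrow> (nat \<Rightarrow> 'q) \<Rightarrow> nat list \<Rightarrow> ('p, 'q, 'n :: {finite, linorder}) ugl" where
  "schur_elt \<alpha> \<beta> lam = scal (1 / of_nat (hook_prod (conj_part lam))) *
     (\<Sum>S | has_shape S (conj_part lam) \<and> (\<forall>row \<in> set S. sorted_wrt (<) row).
        double_young_capelli \<alpha> \<beta> (conj_part lam) S S)"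

text \<open>\<open>\<^bold>I\<^sub>k(n)\<close>, computed with the virtual symbol \<open>\<beta>\<close>.\<close>

definition nazarov_elt :: "'q \<Rightarrow> nat \<Rightarrow> ('p, 'q, 'n :: {finite, linorder}) ugl" where
  "nazarov_elt \<beta> k = (\<Sum>h | (\<Sum>i\<in>UNIV. h i) = k.
     scal (1 / of_nat (\<Prod>i\<in>UNIV. fact (h i))) *
     devirt (prod_list (map (\<lambda>i. e (Prop i) (Neg \<beta>) ^ h i) (rev (sorted_list_of_set (UNIV :: 'n set))))
       * prod_list (map (\<lambda>i. e (Neg \<beta>) (Prop i) ^ h i) (sorted_list_of_set (UNIV :: 'n set)))))"

end

theory Submission
  imports Defs "HOL-Combinatorics.Multiset_Permutations"
begin

text \<open>The projection \<open>\<pp>\<close> is well defined because \<open>Ugln \<inter> Irr = 0\<close>. This is seen without a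
  Poincare-Birkhoff-Witt theorem on the module coinduced from the left multiplication of \<open>gl(n)\<close> on
  the enveloping algebra itself: every irregular product annihilates the vacuum for reasons of weight,
  while \<open>u \<in> Ugln\<close> maps the vacuum to a vector with leading coefficient \<open>u\<close>.

  For a column \<open>S = (i\<^sub>1, \<dots>, i\<^sub>k)\<close>, moving the \<open>e\<^bsub>\<beta>,\<alpha>\<^esub>\<close> and then the \<open>e\<^bsub>i,\<alpha>\<^esub>\<close> to the right, modulo \<open>Irr\<close>,
  turns the argument of \<open>\<pp>\<close> in the double Young-Capelli bitableau into the product of
  \<open>e\<^bsub>i\<^sub>1,\<beta>\<^esub> \<cdots> e\<^bsub>i\<^sub>k,\<beta>\<^esub>\<close> and \<open>e\<^bsub>\<beta>,i\<^sub>1\<^esub> \<cdots> e\<^bsub>\<beta>,i\<^sub>k\<^esub>\<close>; the same sign occurs twice. The factors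
  within each half commute, so the result depends only on the content \<open>h\<close> of \<open>S\<close>, and there are
  \<open>k! / (h\<^sub>1! \<cdots> h\<^sub>n!)\<close> columns of content \<open>h\<close>.\<close>

section \<open>Scalars and commutators\<close>

lemma scal_1 [simp]: "scal 1 = 1"
  by transfer (simp add: equivp_reflp[OF equivp_gl_rel])

lemma scal_0 [simp]: "scal 0 = 0"
  by transfer (simp add: equivp_reflp[OF equivp_gl_rel])

lemma scal_add: "scal (c + d) = scal c + scal d"
  by transfer (simp add: equivp_reflp[OF equivp_gl_rel] single_add)

lemma scal_mult: "scal (c * d) = scal c * scal d"
  by transfer (simp add: equivp_reflp[OF equivp_gl_rel] mult_single)

lemma scal_uminus: "scal (- c) = - scal c"
  using scal_add[of c "- c"] by (simp add: eq_neg_iff_add_eq_0 add.commute)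

lemma scal_minus_one_power [simp]: "scal ((- 1) ^ n) = (- 1) ^ n"
  by (induction n) (simp_all add: scal_uminus)

lemma scal_of_nat: "scal (of_nat n) = of_nat n"
  by (induction n) (simp_all add: scal_add)

lemma poly_mapping_single_induct [case_names zero single add]:
  fixes f :: "'a \<Rightarrow>\<^sub>0 'b :: monoid_add"
  assumes "P 0" "\<And>k v. P (Poly_Mapping.single k v)" "\<And>f g. P f \<Longrightarrow> P g \<Longrightarrow> P (f + g)"
  shows "P f"
proof (induction f rule: update_induct)
  case const
  show ?case by (fact assms(1))
next
  case (update f a b)
  have "Poly_Mapping.update a b f = f + Poly_Mapping.single a b"
    using update(1) by (intro poly_mapping_eqI)
      (auto simp: lookup_update lookup_add lookup_single when_def in_keys_iff)
  then show ?case using assms update by simp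
qed

lemma const_central: "const c * f = f * (const c :: 'a free_alg)"
  by (induction f rule: poly_mapping_single_induct)
    (simp_all add: mult_single mult.commute algebra_simps)

lemma scal_central: "scal c * x = x * scal c"
  by transfer (simp add: equivp_reflp[OF equivp_gl_rel] const_central)

lemma e_commutator:
  "e a b * e c d = (- 1) ^ ((par a + par b) * (par c + par d)) * (e c d * e a b)
     + (if b = c then e a d else 0)
     - (- 1) ^ ((par a + par b) * (par c + par d)) * (if a = d then e c b else 0)"
  using e_supercommute[of a b c d] by (simp add: algebra_simps)

section \<open>A coinduced module\<close>

definition deg :: "('p, 'q, 'n) unit_symb \<Rightarrow> nat" where
  "deg x = par (fst x) + par (snd x)"

text \<open>The sign is taken in the ring itself, so that sign identities reduce to the cases 1 and
  -1 and no scalars intervene.\<close>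

definition ksgn :: "('p, 'q, 'n) unit_symb \<Rightarrow> ('p, 'q, 'n) unit_symb \<Rightarrow> ('p, 'q, 'n) ugl" where
  "ksgn x y = (- 1) ^ (deg x * deg y)"

text \<open>The bracket \<open>[x, y]\<close> is kept as a functional: \<open>br x y A\<close> is the value at \<open>[x, y]\<close> of the linear
  extension of \<open>A\<close>.\<close>

definition br :: "('p, 'q, 'n) unit_symb \<Rightarrow> ('p, 'q, 'n) unit_symb \<Rightarrow>
    (('p, 'q, 'n) unit_symb \<Rightarrow> ('p, 'q, 'n) ugl) \<Rightarrow> ('p, 'q, 'n) ugl" where
  "br x y A = (if snd x = fst y then A (fst x, snd y) else 0)
     - ksgn x y * (if fst x = snd y then A (fst y, snd x) else 0)"

lemma ksgn_cases: "ksgn x y = 1 \<or> ksgn x y = - 1"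
  unfolding ksgn_def by (metis neg_one_even_power neg_one_odd_power)

lemma ksgn_central: "ksgn x y * v = v * ksgn x y"
  using ksgn_cases[of x y] by auto

lemma ksgn_sym: "ksgn x y = ksgn y x"
  by (simp add: ksgn_def mult.commute)

lemma ksgn_sq: "ksgn x y * ksgn x y = 1"
  using ksgn_cases[of x y] by auto

lemma ksgn_sq': "ksgn x y * (ksgn x y * v) = v"
  by (simp add: mult.assoc[symmetric] ksgn_sq)

lemma br_add: "br x y (\<lambda>z. A z + B z) = br x y A + br x y B"
  by (simp add: br_def algebra_simps)

lemma br_mult: "(\<And>v. s * v = v * s) \<Longrightarrow> br x y (\<lambda>z. s * A z) = s * br x y A"
  by (simp add: br_def algebra_simps)

lemma deg_mod:
  "snd x = fst y \<Longrightarrow> even (deg (fst x, snd y)) \<longleftrightarrow> even (deg x + deg y)"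
  "fst x = snd y \<Longrightarrow> even (deg (fst y, snd x)) \<longleftrightarrow> even (deg x + deg y)"
  by (simp_all add: deg_def) blast+

text \<open>All units occurring in [x, y] have the parity of \<open>deg x + deg y\<close>. The
  assumption hands this parity over, so that \<open>ksgn_mult\<close> can split signs under a
  bracket.\<close>

lemma br_cong:
  assumes "\<And>z. even (deg z) \<longleftrightarrow> even (deg x + deg y) \<Longrightarrow> A z = B z"
  shows "br x y A = br x y B"
  using assms deg_mod[of x y] by (auto simp: br_def)

lemma ksgn_mult:
  assumes "even (deg z) \<longleftrightarrow> even (deg x + deg y)"
  shows "ksgn z w = ksgn x w * ksgn y w"
proof -
  have "even (deg z * deg w) \<longleftrightarrow> even (deg x * deg w + deg y * deg w)"
    using assms by auto
  then show ?thesis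
    unfolding ksgn_def power_add[symmetric]
    by (metis neg_one_even_power neg_one_odd_power)
qed

lemma br_anti: "br x y A = - (ksgn x y * br y x A)"
  by (simp add: br_def ksgn_sym[of y x] algebra_simps ksgn_sq')

text \<open>The product of matrix units; the Jacobi identity reduces to its associativity.\<close>

definition mu :: "('p, 'q, 'n) unit_symb \<Rightarrow> ('p, 'q, 'n) unit_symb \<Rightarrow>
    (('p, 'q, 'n) unit_symb \<Rightarrow> ('p, 'q, 'n) ugl) \<Rightarrow> ('p, 'q, 'n) ugl" where
  "mu x y A = (if snd x = fst y then A (fst x, snd y) else 0)"

lemma br_mu: "br x y A = mu x y A - ksgn x y * mu y x A"
  by (auto simp: br_def mu_def)

lemma mu_assoc: "mu y z (\<lambda>w. mu x w A) = mu x y (\<lambda>w. mu w z A)"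
  by (simp add: mu_def)

lemma mu_lin: "mu x y (\<lambda>z. A z - s * B z) = mu x y A - s * mu x y B"
  by (simp add: mu_def)

text \<open>Read [xy, w] = xyw - \<epsilon> wxy among products of matrix units; the sign \<epsilon>
  of xy and w factors because parity is additive, and \<open>mu_assoc\<close> brings all triple
  products to left bracketing.\<close>

lemma mu_br_left:
  "mu x y (\<lambda>z. br z w A) = mu x y (\<lambda>z. mu z w A) - ksgn x w * ksgn y w * mu w x (\<lambda>z. mu z y A)"
  unfolding mu_assoc[of x y w A, symmetric] mu_lin[symmetric]
  using ksgn_mult[of "(fst x, snd y)" x y w] deg_mod(1)[of x y] by (auto simp: mu_def br_mu)

lemma mu_br_right:
  "mu x y (\<lambda>z. br w z A) = mu w x (\<lambda>z. mu z y A) - ksgn x w * ksgn y w * mu x y (\<lambda>z. mu z w A)"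
  unfolding mu_assoc[of x y w A, symmetric] mu_lin[symmetric]
  using ksgn_mult[of "(fst x, snd y)" x y w] deg_mod(1)[of x y]
  by (auto simp: mu_def br_mu ksgn_sym[of w])

text \<open>After expansion both sides are combinations of the same left-bracketed triple products,
  which match for every choice of the three signs. Nested \<open>br\<close> evaluate
  \<open>A\<close> at iterated brackets, so this is the derivation form [y, [x, x']] = [[y, x], x']
  + \<epsilon> [x, [y, x']], suited to moving y past x and x'.\<close>

lemma jacobi:
  "ksgn x y * br y x' (\<lambda>z. br x z A) + br y x (\<lambda>z. br z x' A) = br x x' (\<lambda>z. br y z A)"
proof -
  have eq: "ksgn y x = ksgn x y" "ksgn x' y = ksgn y x'" "ksgn x' x = ksgn x x'"
    by (simp_all add: ksgn_sym)
  show ?thesis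
    unfolding br_mu[of y x'] br_mu[of y x] br_mu[of x x'] mu_br_left mu_br_right eq
    using ksgn_cases[of x y] ksgn_cases[of y x'] ksgn_cases[of x x']
    by (elim disjE) (simp_all)
qed

section \<open>The action of matrix units on covectors\<close>

type_synonym ('p, 'q, 'n) letter = "'n \<times> ('p + 'q)"

text \<open>The letter \<open>(i, \<gamma>)\<close> stands for \<open>e\<^bsub>i,\<gamma>\<^esub>\<close>. A covector \<open>F\<close> represents a vector \<open>v\<close> of the module by
  the \<open>ugl\<close>-valued vacuum components \<open>F [y\<^sub>1, \<dots>, y\<^sub>r]\<close> of \<open>y\<^sub>r \<cdots> y\<^sub>1 v\<close>. Commuting \<open>y\<close> past \<open>x\<close> in
  \<open>y x v\<close> gives the recursion that defines the action \<open>act\<close> of \<open>x\<close>.\<close>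

type_synonym ('p, 'q, 'n) covec = "('p, 'q, 'n) letter list \<Rightarrow> ('p, 'q, 'n) ugl"

fun emb :: "('p, 'q, 'n) letter \<Rightarrow> ('p, 'q, 'n) unit_symb" where
  "emb (i, Inl p) = (Prop i, Pos p)"
| "emb (i, Inr q) = (Prop i, Neg q)"

fun low :: "('p, 'q, 'n) unit_symb \<Rightarrow> ('p, 'q, 'n) letter option" where
  "low (Prop i, Pos p) = Some (i, Inl p)"
| "low (Prop i, Neg q) = Some (i, Inr q)"
| "low _ = None"

lemma low_emb [simp]: "low (emb y) = Some y"
  by (cases y rule: emb.cases) auto

lemma low_SomeD: "low x = Some y \<Longrightarrow> x = emb y"
  by (cases x rule: low.cases) auto

lemma low_None_cases:
  assumes "low x = None"
  obtains (Prop) i j where "x = (Prop i, Prop j)" | (Pos) p b where "x = (Pos p, b)"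
    | (Neg) q b where "x = (Neg q, b)"
  using assms by (cases x rule: low.cases) (auto, metis low.simps is_virtual.cases option.distinct(1))

lemma emb_cases:
  obtains (emb) y where "x = emb y" | (None) "low x = None"
  using low_SomeD by (metis option.exhaust)

lemma br_emb_emb [simp]: "br (emb y) (emb z) A = 0"
  by (cases y rule: emb.cases; cases z rule: emb.cases) (auto simp: br_def)

text \<open>On the units other than letters, which span a subalgebra, this is the representation
  from which the module is coinduced.\<close>

fun vac :: "('p, 'q, 'n) unit_symb \<Rightarrow> ('p, 'q, 'n) ugl \<Rightarrow> ('p, 'q, 'n) ugl" where
  "vac (Prop i, Prop j) v = e (Prop i) (Prop j) * v"
| "vac _ v = 0"

primrec eval_act :: "('p, 'q, 'n) letter list \<Rightarrow> ('p, 'q, 'n) unit_symb \<Rightarrow> ('p, 'q, 'n) covec \<Rightarrow>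
    ('p, 'q, 'n) ugl" where
  "eval_act [] x F = (case low x of Some y \<Rightarrow> F [y] | None \<Rightarrow> vac x (F []))"
| "eval_act (y # l) x F = (case low x of Some z \<Rightarrow> F (z # y # l) | None \<Rightarrow>
     ksgn (emb y) x * eval_act l x (\<lambda>l'. F (y # l')) + br (emb y) x (\<lambda>z. eval_act l z F))"

definition act :: "('p, 'q, 'n) unit_symb \<Rightarrow> ('p, 'q, 'n) covec \<Rightarrow> ('p, 'q, 'n) covec" where
  "act x F = (\<lambda>l. eval_act l x F)"

lemma act_emb [simp]: "act (emb y) F l = F (y # l)"
  unfolding act_def by (cases l) auto

lemma act_emb_fun: "act (emb y) F = (\<lambda>l. F (y # l))"
  by (rule ext) simp

lemma act_Nil: "low x = None \<Longrightarrow> act x F [] = vac x (F [])"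
  by (simp add: act_def)

lemma act_Cons: "low x = None \<Longrightarrow> act x F (y # l) =
    ksgn (emb y) x * act x (act (emb y) F) l + br (emb y) x (\<lambda>z. act z F l)"
  by (simp add: act_def act_emb[unfolded act_def])

lemma vac_add: "vac x (v + w) = vac x v + vac x w"
  by (cases "(x, v)" rule: vac.cases) (auto simp: algebra_simps)

lemma vac_mult: "(\<And>v. s * v = v * s) \<Longrightarrow> vac x (s * v) = s * vac x v"
  by (cases "(x, v)" rule: vac.cases) (simp_all, metis mult.assoc)

lemma act_add: "act x (\<lambda>l. F l + G l) l = act x F l + act x G l"
proof (induction l arbitrary: x F G)
  case Nil
  then show ?case by (cases x rule: emb_cases) (simp_all add: act_Nil vac_add)
next
  case (Cons y l)
  then show ?case
    by (cases x rule: emb_cases) (simp_all add: act_Cons act_emb_fun br_add algebra_simps)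
qed

lemma act_mult:
  assumes "\<And>v. s * v = v * s"
  shows "act x (\<lambda>l. s * F l) l = s * act x F l"
proof (induction l arbitrary: x F)
  case Nil
  then show ?case by (cases x rule: emb_cases) (simp_all add: act_Nil vac_mult[OF assms])
next
  case (Cons y l)
  have "ksgn (emb y) x * (s * v) = s * (ksgn (emb y) x * v)" for v
    by (metis assms mult.assoc)
  with Cons show ?case
    by (cases x rule: emb_cases)
      (simp_all add: act_Cons act_emb_fun br_mult[OF assms] distrib_left)
qed

lemma act_zero [simp]: "act x (\<lambda>l. 0) l = 0"
  using act_mult[of 0 x "\<lambda>l. 0" l] by simp

lemma act_diff: "act x (\<lambda>l. F l - G l) l = act x F l - act x G l"
  using act_add[of x "\<lambda>l. F l - G l" G l] by (simp add: algebra_simps)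

lemma act_br: "act x (\<lambda>l. br y z (\<lambda>w. G w l)) l = br y z (\<lambda>w. act x (G w) l)"
  by (simp add: br_def act_diff act_mult[OF ksgn_central])

text \<open>Letters supercommute in the Lie superalgebra, so the components of a vector of the
  coinduced module must satisfy this; \<open>act\<close> is shown to respect brackets on such
  functions.\<close>

definition supersymmetric :: "('p, 'q, 'n) covec \<Rightarrow> bool" where
  "supersymmetric F \<longleftrightarrow>
     (\<forall>k y z l. F (k @ y # z # l) = ksgn (emb y) (emb z) * F (k @ z # y # l))"

lemma supersymmetricD:
  "supersymmetric F \<Longrightarrow> F (k @ y # z # l) = ksgn (emb y) (emb z) * F (k @ z # y # l)"
  unfolding supersymmetric_def by blast

lemma supersymmetric_emb: "supersymmetric F \<Longrightarrow> supersymmetric (act (emb y) F)"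
  unfolding supersymmetric_def by (metis act_emb append_Cons)

text \<open>If x is not a letter, this is the recursion for \<open>act\<close>; if x is a letter,
  the bracket vanishes and supersymmetry of F remains. Later arguments thus need no case
  distinction.\<close>

lemma act_emb_left:
  assumes "supersymmetric F"
  shows "act (emb y) (act x F) l = ksgn (emb y) x * act x (act (emb y) F) l
    + br (emb y) x (\<lambda>z. act z F l)"
proof (cases "low x")
  case None
  then show ?thesis by (simp add: act_Cons)
next
  case (Some z)
  then show ?thesis using supersymmetricD[OF assms, of "[]" z y l]
    by (auto dest!: low_SomeD simp: ksgn_sym[of "emb y" "emb z"] ksgn_sq')
qed

lemma act_emb_right:
  assumes "supersymmetric F"
  shows "act x (act (emb y) F) l = ksgn x (emb y) * act (emb y) (act x F) l
    + br x (emb y) (\<lambda>z. act z F l)"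
  unfolding act_emb_left[OF assms, of y x] br_anti[of x "emb y"] ksgn_sym[of x "emb y"]
  by (simp add: distrib_left ksgn_sq')

text \<open>On gl(n) this is the commutator relation of \<open>ugl\<close> itself. The
  e_{\<gamma>,b} with \<gamma> virtual span an ideal in the subalgebra of the units other than
  letters, so they can act by zero.\<close>

lemma vac_bracket:
  assumes "low x = None" "low x' = None"
  shows "vac x (vac x' v) = ksgn x x' * vac x' (vac x v) + br x x' (\<lambda>z. vac z v)"
proof -
  have comm: "e (Prop i) (Prop j) * (e (Prop k) (Prop l) * v) =
     e (Prop k) (Prop l) * (e (Prop i) (Prop j) * v) +
     ((if j = k then e (Prop i) (Prop l) * v else 0) - (if i = l then e (Prop k) (Prop j) * v else 0))"
    for i j k l
  proof -
    have "e (Prop i) (Prop j) * e (Prop k) (Prop l) * v =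
      (e (Prop k) (Prop l) * e (Prop i) (Prop j) +
        ((if j = k then e (Prop i) (Prop l) else 0) - (if i = l then e (Prop k) (Prop j) else 0))) * v"
      by (subst e_commutator) simp
    then show ?thesis by (simp add: distrib_right left_diff_distrib mult.assoc)
  qed
  show ?thesis
  proof (cases rule: low_None_cases[OF assms(1)]; cases rule: low_None_cases[OF assms(2)])
    fix i j k l
    assume "x = (Prop i, Prop j)" "x' = (Prop k, Prop l)"
    then show ?thesis using comm[of i j k l] by (simp add: br_def ksgn_def deg_def)
  qed (auto simp: br_def)
qed

text \<open>Induction on the list. If x or x' is a letter, commuting with a letter is already known.
  Otherwise the first letter y of the list is moved past x and x' on both sides; the induction
  hypothesis treats the shorter list, and the remaining double brackets cancel by
  \<open>jacobi\<close>.\<close>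

lemma act_bracket:
  assumes "supersymmetric F"
  shows "act x (act x' F) l = ksgn x x' * act x' (act x F) l + br x x' (\<lambda>z. act z F l)"
  using assms
proof (induction l arbitrary: x x' F)
  case Nil
  consider y where "x = emb y" | y where "x' = emb y" | "low x = None" "low x' = None"
    by (metis emb_cases)
  then show ?case
  proof cases
    case 1
    show ?thesis unfolding 1 by (rule act_emb_left[OF Nil])
  next
    case 2
    show ?thesis unfolding 2 by (rule act_emb_right[OF Nil])
  next
    case 3
    \<comment> \<open>The bracket of two units that are not letters contains no letter, so
      \<open>act_Nil\<close> applies to each of its terms.\<close>
    have "br x x' (\<lambda>z. act z F []) = br x x' (\<lambda>z. vac z (F []))"

      by (cases rule: low_None_cases[OF 3(1)]; cases rule: low_None_cases[OF 3(2)]) (auto simp: br_def act_Nil)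
    then show ?thesis using 3 vac_bracket[OF 3] by (simp add: act_Nil)
  qed
next
  case (Cons y l)
  consider y where "x = emb y" | y where "x' = emb y" | "low x = None" "low x' = None"
    by (metis emb_cases)
  then show ?case
  proof cases
    case 1
    show ?thesis unfolding 1 by (rule act_emb_left[OF Cons.prems])
  next
    case 2
    show ?thesis unfolding 2 by (rule act_emb_right[OF Cons.prems])
  next
    case 3
    let ?y = "emb y"
    note IH = Cons.IH and F = Cons.prems
    have step: "act x (act x' F) (y # l) =
        ksgn ?y x * (ksgn ?y x' * act x (act x' (act ?y F)) l)
        + ksgn ?y x * br ?y x' (\<lambda>z. act x (act z F) l)
        + br ?y x (\<lambda>z. act z (act x' F) l)"
      if "low x = None" for x x'
    proof -
      have "act ?y (act x' F) = (\<lambda>l. ksgn ?y x' * act x' (act ?y F) l + br ?y x' (\<lambda>z. act z F l))"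
        using act_emb_left[OF F] by blast
      then have "act x (act ?y (act x' F)) l =
        ksgn ?y x' * act x (act x' (act ?y F)) l + br ?y x' (\<lambda>z. act x (act z F) l)"
        by (simp add: act_add act_mult[OF ksgn_central] act_br)
      then show ?thesis using that by (simp add: act_Cons distrib_left)
    qed
    \<comment> \<open>Every unit z of [y, x'] has the parity of y plus that of x', so the sign of z
      and x is the same for all of them and leaves the bracket.\<close>
    have A: "br ?y x' (\<lambda>z. act x (act z F) l) =
        ksgn ?y x * ksgn x x' * br ?y x' (\<lambda>z. act z (act x F) l)
        + br ?y x' (\<lambda>z. br x z (\<lambda>w. act w F l))"
    proof -
      have "br ?y x' (\<lambda>z. act x (act z F) l) =
        br ?y x' (\<lambda>z. ksgn ?y x * ksgn x x' * act z (act x F) l + br x z (\<lambda>w. act w F l))"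
        by (intro br_cong) (simp only: IH[OF F, of x] ksgn_mult[of _ ?y x' x] ksgn_sym[of x])
      also have "\<dots> = ksgn ?y x * ksgn x x' * br ?y x' (\<lambda>z. act z (act x F) l)
        + br ?y x' (\<lambda>z. br x z (\<lambda>w. act w F l))"
        unfolding br_add by (subst br_mult) (metis ksgn_central mult.assoc, simp)
      finally show ?thesis .
    qed
    have B: "br ?y x (\<lambda>z. act z (act x' F) l) =
        ksgn ?y x' * ksgn x x' * br ?y x (\<lambda>z. act x' (act z F) l)
        + br ?y x (\<lambda>z. br z x' (\<lambda>w. act w F l))"
    proof -
      have "br ?y x (\<lambda>z. act z (act x' F) l) =
        br ?y x (\<lambda>z. ksgn ?y x' * ksgn x x' * act x' (act z F) l + br z x' (\<lambda>w. act w F l))"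
        by (intro br_cong) (simp only: IH[OF F, of _ x'] ksgn_mult[of _ ?y x x'])
      also have "\<dots> = ksgn ?y x' * ksgn x x' * br ?y x (\<lambda>z. act x' (act z F) l)
        + br ?y x (\<lambda>z. br z x' (\<lambda>w. act w F l))"
        unfolding br_add by (subst br_mult) (metis ksgn_central mult.assoc, simp)
      finally show ?thesis .
    qed
    have C: "br x x' (\<lambda>z. act z F (y # l)) =
        ksgn ?y x * ksgn ?y x' * br x x' (\<lambda>z. act z (act ?y F) l)
        + br x x' (\<lambda>z. br ?y z (\<lambda>w. act w F l))"
    proof -
      have "br x x' (\<lambda>z. act z F (y # l)) =
        br x x' (\<lambda>z. ksgn ?y x * ksgn ?y x' * act z (act ?y F) l + br ?y z (\<lambda>w. act w F l))"
        using act_emb_left[OF F, of y _ l]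
        by (intro br_cong) (simp only: act_emb ksgn_mult[of _ x x' ?y] ksgn_sym[of ?y])
      also have "\<dots> = ksgn ?y x * ksgn ?y x' * br x x' (\<lambda>z. act z (act ?y F) l)
        + br x x' (\<lambda>z. br ?y z (\<lambda>w. act w F l))"
        unfolding br_add by (subst br_mult) (metis ksgn_central mult.assoc, simp)
      finally show ?thesis .
    qed
    have D: "act x (act x' (act ?y F)) l = ksgn x x' * act x' (act x (act ?y F)) l
       + br x x' (\<lambda>z. act z (act ?y F) l)"
      using IH supersymmetric_emb[OF F] by blast
    have J: "br x x' (\<lambda>z. br ?y z (\<lambda>w. act w F l)) =
        ksgn x ?y * br ?y x' (\<lambda>z. br x z (\<lambda>w. act w F l)) + br ?y x (\<lambda>z. br z x' (\<lambda>w. act w F l))"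
      using jacobi by metis
    show ?thesis
      unfolding step[OF 3(1)] step[OF 3(2)] A B C D J
      using ksgn_cases[of ?y x] ksgn_cases[of ?y x'] ksgn_cases[of x x']
      by (elim disjE) (simp_all add: ksgn_sym[of x' x] ksgn_sym[of x ?y])
  qed
qed

text \<open>Exchange the letters y and z in the expanded component: the terms without bracket agree
  by supersymmetry of F, the two kinds of terms with one bracket trade places, and the double
  brackets agree by \<open>jacobi\<close> because [y, z] = 0. Letters in front are peeled off by
  induction on k.\<close>

lemma supersymmetric_act:
  assumes "supersymmetric F"
  shows "supersymmetric (act x F)"
proof -
  have "act x F (k @ y # z # l) = ksgn (emb y) (emb z) * act x F (k @ z # y # l)"
    for k y z l
    using assms
  proof (induction k arbitrary: x F)
    case Nil
    note F = Nil
    have step: "act x F (y # z # l) =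
        ksgn (emb y) x * (ksgn (emb z) x * act x (act (emb z) (act (emb y) F)) l
          + br (emb z) x (\<lambda>w. act w (act (emb y) F) l))
        + ksgn (emb z) (emb y) * ksgn (emb z) x * br (emb y) x (\<lambda>w. act w (act (emb z) F) l)
        + br (emb y) x (\<lambda>w. br (emb z) w (\<lambda>v. act v F l))" for y z
    proof -
      have "act (emb y) (act x F) =
          (\<lambda>l. ksgn (emb y) x * act x (act (emb y) F) l + br (emb y) x (\<lambda>w. act w F l))"
        using act_emb_left[OF F] by blast
      then have "act x F (y # z # l) = ksgn (emb y) x * act (emb z) (act x (act (emb y) F)) l
          + br (emb y) x (\<lambda>w. act (emb z) (act w F) l)"
        unfolding act_emb by metis
      also have "br (emb y) x (\<lambda>w. act (emb z) (act w F) l) =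
          br (emb y) x (\<lambda>w. ksgn (emb z) (emb y) * ksgn (emb z) x * act w (act (emb z) F) l
            + br (emb z) w (\<lambda>v. act v F l))"
        using act_emb_left[OF F, of z _ l]
        by (intro br_cong) (simp only: ksgn_mult[of _ "emb y" x "emb z"] ksgn_sym[of "emb z"])
      also have "\<dots> = ksgn (emb z) (emb y) * ksgn (emb z) x * br (emb y) x (\<lambda>w. act w (act (emb z) F) l)
        + br (emb y) x (\<lambda>w. br (emb z) w (\<lambda>v. act v F l))"
        unfolding br_add by (subst br_mult) (metis ksgn_central mult.assoc, simp)
      also have "act (emb z) (act x (act (emb y) F)) l =
          ksgn (emb z) x * act x (act (emb z) (act (emb y) F)) l
          + br (emb z) x (\<lambda>w. act w (act (emb y) F) l)"
        by (rule act_emb_left[OF supersymmetric_emb[OF F]])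
      finally show ?thesis by (simp only: add.assoc)
    qed
    have "act (emb z) (act (emb y) F) = (\<lambda>l. ksgn (emb y) (emb z) * act (emb y) (act (emb z) F) l)"
      using supersymmetricD[OF F, of "[]" y z] by (intro ext) simp
    then have A: "act x (act (emb z) (act (emb y) F)) l =
        ksgn (emb y) (emb z) * act x (act (emb y) (act (emb z) F)) l"
      by (simp only: act_mult[OF ksgn_central])
    have J: "br (emb z) x (\<lambda>w. br (emb y) w (\<lambda>v. act v F l)) =
        ksgn (emb y) (emb z) * br (emb y) x (\<lambda>w. br (emb z) w (\<lambda>v. act v F l))"
      using jacobi[of "emb z" "emb y" x "\<lambda>v. act v F l"] by (simp add: ksgn_sym[of "emb z"])
    have S: "ksgn (emb z) (emb y) = ksgn (emb y) (emb z)"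
      by (rule ksgn_sym)
    show ?case
      unfolding append_Nil step A J S
      using ksgn_cases[of "emb y" "emb z"] ksgn_cases[of "emb y" x] ksgn_cases[of "emb z" x]
      by (elim disjE) (simp_all add: algebra_simps)
  next
    case (Cons c k)
    have br: "br (emb c) x (\<lambda>w. act w F (k @ y # z # l)) =
        ksgn (emb y) (emb z) * br (emb c) x (\<lambda>w. act w F (k @ z # y # l))"
      by (simp only: Cons.IH[OF Cons.prems] br_mult[OF ksgn_central])
    show ?case
    proof (cases "low x")
      case None
      have "act x F (c # k @ y # z # l) = ksgn (emb y) (emb z) * act x F (c # k @ z # y # l)"
        unfolding act_Cons[OF None] br Cons.IH[OF supersymmetric_emb[OF Cons.prems]]
        using ksgn_cases[of "emb y" "emb z"] by auto
      then show ?thesis by simp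
    next
      case (Some v)
      then show ?thesis
        using low_SomeD[OF Some] supersymmetricD[OF Cons.prems, of "v # c # k" y z l] by simp
    qed
  qed
  then show ?thesis unfolding supersymmetric_def by blast
qed

section \<open>Weights, and irregular products on the vacuum\<close>

definition symb_count :: "('p, 'q, 'n) symb \<Rightarrow> ('p, 'q, 'n) letter list \<Rightarrow> nat" where
  "symb_count \<gamma> l = count_list (map (snd \<circ> emb) l) \<gamma>"

lemma symb_count_Nil [simp]: "symb_count \<gamma> [] = 0"
  by (simp add: symb_count_def)

lemma symb_count_Cons [simp]:
  "symb_count \<gamma> (y # l) = of_bool (snd (emb y) = \<gamma>) + symb_count \<gamma> l"
  by (simp add: symb_count_def)

lemma fst_emb: "is_virtual \<gamma> \<Longrightarrow> fst (emb y) \<noteq> \<gamma>"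
  by (cases y rule: emb.cases) auto

lemma br_nonzero:
  "br x y A \<noteq> 0 \<Longrightarrow>
    snd x = fst y \<and> A (fst x, snd y) \<noteq> 0 \<or> fst x = snd y \<and> A (fst y, snd x) \<noteq> 0"
  by (rule ccontr) (auto simp: br_def split: if_splits)

text \<open>The unit e_{a,b} creates a and destroys b, so it shifts the weight at \<gamma>
  accordingly. A covector has weight k - m here; keeping m separate avoids subtraction of natural
  numbers and absorbs the letter when the induction passes to \<open>act (emb y) F\<close>.\<close>

lemma act_weight:
  assumes "is_virtual \<gamma>" and "\<And>l. F l \<noteq> 0 \<Longrightarrow> symb_count \<gamma> l + m = k" and "act (a, b) F l \<noteq> 0"
  shows "symb_count \<gamma> l + m + of_bool (b = \<gamma>) = k + of_bool (a = \<gamma>)"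
  using assms(2,3)
proof (induction l arbitrary: a b F m k)
  case Nil
  show ?case
  proof (cases "low (a, b)")
    case None
    then obtain i j where ij: "a = Prop i" "b = Prop j"
      using Nil(2) by (cases rule: low_None_cases[OF None]) (auto simp: act_Nil)
    then have "F [] \<noteq> 0"
      using Nil(2) None by (auto simp: act_Nil)
    with Nil(1)[of "[]"] ij assms(1) show ?thesis by auto
  next
    case (Some z)
    then have ab: "(a, b) = emb z" by (rule low_SomeD)
    then have "a \<noteq> \<gamma>" "b = snd (emb z)" using fst_emb[OF assms(1), of z] by (metis prod.sel)+
    then show ?thesis using Nil(1)[of "[z]"] Nil(2) unfolding ab by simp
  qed
next
  case (Cons y l)
  show ?case
  proof (cases "low (a, b)")
    case None
    have "act (a, b) (act (emb y) F) l \<noteq> 0 \<or> br (emb y) (a, b) (\<lambda>z. act z F l) \<noteq> 0"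
      using Cons.prems(2) by (auto simp: act_Cons[OF None])
    then consider "act (a, b) (act (emb y) F) l \<noteq> 0"
      | "snd (emb y) = a" "act (fst (emb y), b) F l \<noteq> 0"
      | "fst (emb y) = b" "act (a, snd (emb y)) F l \<noteq> 0"
      using br_nonzero[of "emb y" "(a, b)" "\<lambda>z. act z F l"] by auto
    then show ?thesis
    proof cases
      case 1
      have "symb_count \<gamma> l' + (m + of_bool (snd (emb y) = \<gamma>)) = k" if "act (emb y) F l' \<noteq> 0" for l'
        using Cons.prems(1)[of "y # l'"] that by simp
      from Cons.IH[OF this 1] show ?thesis by simp
    next
      case 2
      from Cons.IH[OF Cons.prems(1) 2(2)] 2(1) fst_emb[OF assms(1), of y]
      show ?thesis by simp
    next
      case 3
      from Cons.IH[OF Cons.prems(1) 3(2)] 3(1) fst_emb[OF assms(1), of y]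
      show ?thesis by auto
    qed
  next
    case (Some z)
    then have ab: "(a, b) = emb z" by (rule low_SomeD)
    then have "a \<noteq> \<gamma>" "b = snd (emb z)" using fst_emb[OF assms(1), of z] by (metis prod.sel)+
    then show ?thesis using Cons.prems(1)[of "z # y # l"] Cons.prems(2) unfolding ab by simp
  qed
qed

text \<open>Weights alone do not kill an irregular product starting with e_{\<gamma>,\<gamma>},
  which preserves weight; its eigenvalue 0 at weight 0 does.\<close>

lemma act_diagonal:
  assumes "is_virtual \<gamma>"
  shows "act (\<gamma>, \<gamma>) F l = of_nat (symb_count \<gamma> l) * F l"
proof (induction l arbitrary: F)
  case Nil
  then show ?case using assms by (cases \<gamma>) (simp_all add: act_Nil)
next
  case (Cons y l)
  have "low (\<gamma>, \<gamma>) = None"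
    using assms by (cases \<gamma>) simp_all
  moreover have "ksgn (emb y) (\<gamma>, \<gamma>) = 1"
    by (simp add: ksgn_def deg_def mult_2[symmetric])
  moreover have "act (fst (emb y), \<gamma>) F l = F (y # l)" if "snd (emb y) = \<gamma>"
    using that by (metis act_emb prod.collapse)
  ultimately show ?case
    using Cons fst_emb[OF assms, of y] by (auto simp: act_Cons br_def distrib_right)
qed

definition vacuum :: "('p, 'q, 'n) covec" where
  "vacuum l = of_bool (l = [])"

lemma supersymmetric_vacuum: "supersymmetric vacuum"
  by (simp add: supersymmetric_def vacuum_def)

lemma word_weight:
  assumes "is_virtual \<gamma>" "foldr act w vacuum l \<noteq> 0"
  shows "symb_count \<gamma> l + count_list (map snd w) \<gamma> = count_list (map fst w) \<gamma>"
  using assms(2)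
proof (induction w arbitrary: l)
  case Nil
  then show ?case by (simp add: vacuum_def split: if_splits)
next
  case (Cons x w)
  then show ?case
    using act_weight[OF assms(1) Cons.IH, where a = "fst x" and b = "snd x" and l = l]
    by (auto split: if_splits)
qed

lemma foldr_act_zero: "foldr act w (\<lambda>l. 0) = (\<lambda>l. 0)"
  by (induction w) auto

text \<open>The factors that act before x form the suffix v. In this form irregularity concerns a
  suffix of the word, as suits \<open>foldr\<close>.\<close>

lemma irregular_iff:
  "irregular w \<longleftrightarrow> (\<exists>u x v \<gamma>. w = u @ x # v \<and> is_virtual \<gamma> \<and>
     count_list (map fst v) \<gamma> < count_list (map snd (x # v)) \<gamma>)"
proof -
  \<comment> \<open>The first i factors in the numbering from the right are the last i entries of
    w.\<close>
  have count: "card {j. j < i \<and> f (rev w ! j) = \<gamma>} = count_list (map f (drop (length w - i) w)) \<gamma>"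
    if "i \<le> length w" for f :: "_ \<Rightarrow> ('a, 'b, 'c) symb" and i \<gamma>
  proof -
    have "card {j. j < i \<and> f (rev w ! j) = \<gamma>} = length (filter (\<lambda>z. f z = \<gamma>) (take i (rev w)))"
      unfolding length_filter_conv_card using that by (intro arg_cong[of _ _ card]) auto
    also have "\<dots> = length (filter (\<lambda>z. f z = \<gamma>) (drop (length w - i) w))"
      by (simp add: take_rev rev_filter[symmetric])
    finally show ?thesis
      by (simp add: count_list_eq_length_filter filter_map comp_def eq_commute)
  qed
  have le: "{j. j \<le> i \<and> P j} = {j. j < Suc i \<and> P j}" for i :: nat and P
    by auto
  show ?thesis
  proof
    assume "irregular w"
    then obtain i \<gamma> where i: "i < length w" "is_virtual \<gamma>"
      "count_list (map fst (drop (length w - i) w)) \<gamma>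
        < count_list (map snd (drop (length w - Suc i) w)) \<gamma>"
      unfolding irregular_def le by (auto simp: count)
    have "drop (length w - Suc i) w = w ! (length w - Suc i) # drop (length w - i) w"
      using i(1) Cons_nth_drop_Suc[of "length w - Suc i" w] by (simp add: Suc_diff_Suc)
    moreover from this have "w = take (length w - Suc i) w @ w ! (length w - Suc i) # drop (length w - i) w"
      by (metis append_take_drop_id)
    ultimately show "\<exists>u x v \<gamma>. w = u @ x # v \<and> is_virtual \<gamma> \<and>
     count_list (map fst v) \<gamma> < count_list (map snd (x # v)) \<gamma>"
      using i(2,3) by metis
  next
    assume "\<exists>u x v \<gamma>. w = u @ x # v \<and> is_virtual \<gamma> \<and>
     count_list (map fst v) \<gamma> < count_list (map snd (x # v)) \<gamma>"
    then obtain u x v \<gamma> where w: "w = u @ x # v" "is_virtual \<gamma>"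
      "count_list (map fst v) \<gamma> < count_list (map snd (x # v)) \<gamma>" by blast
    have drop: "drop (length w - length v) w = v" "drop (length w - Suc (length v)) w = x # v"
      "length v < length w" by (simp_all add: w(1))
    then show "irregular w"
      unfolding irregular_def le using w(2,3)
      by (intro exI[of _ "length v"] conjI exI[of _ \<gamma>]) (simp_all only: count drop Suc_leI less_imp_le)
  qed
qed

text \<open>The suffix \<open>x # v\<close> destroys \<gamma> more often than v creates it. If x
  does not create \<gamma>, then \<open>x # v\<close> would produce a negative weight; if x creates
  but does not destroy \<gamma>, already v would; if x is (\<gamma>, \<gamma>), then v can only
  produce weight 0, which x annihilates.\<close>

lemma irregular_vacuum:
  assumes "irregular w"
  shows "foldr act w vacuum = (\<lambda>l. 0)"
proof -
  obtain u x v \<gamma> where w: "w = u @ x # v" and \<gamma>: "is_virtual \<gamma>"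
    and count: "count_list (map fst v) \<gamma> < count_list (map snd (x # v)) \<gamma>"
    using assms unfolding irregular_iff by blast
  let ?F = "foldr act v vacuum"
  have "act x ?F l = 0" for l
  proof (cases "fst x = \<gamma>")
    case True
    show ?thesis
    proof (cases "snd x = \<gamma>")
      case True
      then have "x = (\<gamma>, \<gamma>)" using \<open>fst x = \<gamma>\<close> by (cases x) simp
      moreover have "symb_count \<gamma> l = 0" if "?F l \<noteq> 0"
        using word_weight[OF \<gamma> that] count True by simp
      ultimately show ?thesis
        by (cases "?F l = 0") (simp_all add: act_diagonal[OF \<gamma>])
    next
      case False
      then have "?F l = 0" for l
        using word_weight[OF \<gamma>, of v l] count by (cases "?F l = 0") auto
      then have "?F = (\<lambda>l. 0)" by blast
      then show ?thesis by simp
    qed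
  next
    case False
    then show ?thesis
      using word_weight[OF \<gamma>, of "x # v" l] count by (cases "act x ?F l = 0") auto
  qed
  then have "act x ?F = (\<lambda>l. 0)" by blast
  then show ?thesis by (simp add: w foldr_act_zero)
qed

section \<open>Descent of the action to the enveloping algebra\<close>

definition free_act :: "('p, 'q, 'n) unit_symb free_alg \<Rightarrow> ('p, 'q, 'n) covec \<Rightarrow> ('p, 'q, 'n) covec" where
  "free_act f F l = (\<Sum>w\<in>Poly_Mapping.keys f. scal (Poly_Mapping.lookup f w) * foldr act (letters w) F l)"

lemma foldr_act_add:
  "foldr act w (\<lambda>l. F l + G l) = (\<lambda>l. foldr act w F l + foldr act w G l)"
  by (induction w) (auto simp: act_add)

lemma foldr_act_scal: "foldr act w (\<lambda>l. scal c * F l) = (\<lambda>l. scal c * foldr act w F l)"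
  by (induction w) (auto simp: act_mult[OF scal_central])

lemma free_act_superset:
  assumes "finite A" "Poly_Mapping.keys f \<subseteq> A"
  shows "free_act f F l = (\<Sum>w\<in>A. scal (Poly_Mapping.lookup f w) * foldr act (letters w) F l)"
  unfolding free_act_def using assms
  by (intro sum.mono_neutral_left) (auto simp: in_keys_iff)

lemma free_act_add: "free_act (f + g) F l = free_act f F l + free_act g F l"
proof -
  let ?A = "Poly_Mapping.keys f \<union> Poly_Mapping.keys g"
  have "Poly_Mapping.keys (f + g) \<subseteq> ?A" by (rule keys_add)
  then show ?thesis
    by (simp add: free_act_superset[of ?A] lookup_add scal_add distrib_right sum.distrib)
qed

lemma free_act_0 [simp]: "free_act 0 F l = 0"
  by (simp add: free_act_def)

lemma free_act_uminus: "free_act (- f) F l = - free_act f F l"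
  by (metis free_act_0 free_act_add add.commute add.right_inverse eq_neg_iff_add_eq_0)

lemma free_act_diff: "free_act (f - g) F l = free_act f F l - free_act g F l"
  by (metis free_act_uminus free_act_add diff_conv_add_uminus)

lemma free_act_single:
  "free_act (Poly_Mapping.single w c) F l = scal c * foldr act (letters w) F l"
  by (simp add: free_act_def)

lemma free_act_covec_add: "free_act f (\<lambda>l. F l + G l) l = free_act f F l + free_act f G l"
  by (simp add: free_act_def foldr_act_add distrib_left sum.distrib)

lemma free_act_zero [simp]: "free_act f (\<lambda>l. 0) l = 0"
  by (simp add: free_act_def foldr_act_zero)

lemma free_act_mult: "free_act (f * g) F l = free_act f (free_act g F) l"
proof (induction f arbitrary: l rule: poly_mapping_single_induct)
  case (single w c)
  show ?case
  proof (induction g arbitrary: l rule: poly_mapping_single_induct)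
    case zero
    have "free_act 0 F = (\<lambda>l. 0)" by (rule ext) simp
    then show ?case by simp
  next
    case (single w' c')
    have "free_act (Poly_Mapping.single w' c') F = (\<lambda>l. scal c' * foldr act (letters w') F l)"
      by (rule ext) (simp add: free_act_single)
    then show ?case
      by (simp add: mult_single free_act_single foldr_act_scal scal_mult plus_word_def mult.assoc)
  next
    case (add g h)
    have "free_act (g + h) F = (\<lambda>l. free_act g F l + free_act h F l)"
      by (rule ext) (simp add: free_act_add)
    then show ?case by (simp add: distrib_left free_act_add add free_act_covec_add)
  qed
qed (simp_all add: distrib_right free_act_add)

lemma supersymmetric_zero: "supersymmetric (\<lambda>l. 0)"
  by (simp add: supersymmetric_def)

lemma supersymmetric_add:
  assumes "supersymmetric F" "supersymmetric G"
  shows "supersymmetric (\<lambda>l. F l + G l)"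
  unfolding supersymmetric_def
  using assms[THEN supersymmetricD] by (metis distrib_left)

lemma supersymmetric_scal:
  assumes "supersymmetric F"
  shows "supersymmetric (\<lambda>l. scal c * F l)"
  unfolding supersymmetric_def
  using supersymmetricD[OF assms] by (metis mult.assoc scal_central)

lemma supersymmetric_foldr_act: "supersymmetric F \<Longrightarrow> supersymmetric (foldr act w F)"
  by (induction w) (auto intro: supersymmetric_act)

lemma supersymmetric_free_act:
  assumes "supersymmetric F"
  shows "supersymmetric (free_act f F)"
proof (induction f rule: poly_mapping_single_induct)
  case zero
  then show ?case using supersymmetric_zero by (simp add: free_act_def[abs_def])
next
  case (single w c)
  have "free_act (Poly_Mapping.single w c) F = (\<lambda>l. scal c * foldr act (letters w) F l)"
    by (rule ext) (simp add: free_act_single)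
  then show ?case using assms by (simp add: supersymmetric_scal supersymmetric_foldr_act)
next
  case (add f g)
  have "free_act (f + g) F = (\<lambda>l. free_act f F l + free_act g F l)"
    by (rule ext) (simp add: free_act_add)
  then show ?case using add by (simp add: supersymmetric_add)
qed

lemma free_act_gen: "free_act (gen x) F = act x F"
  by (rule ext) (simp add: free_act_single)

lemma free_act_const: "free_act (const c) F = (\<lambda>l. scal c * F l)"
  by (rule ext) (simp add: free_act_single zero_word_def)

lemma scal_koszul_sign: "scal (koszul_sign x y) = ksgn x y"
  by (simp add: koszul_sign_def ksgn_def deg_def)

lemma free_act_mult_fun: "free_act (f * g) F = free_act f (free_act g F)"
  by (rule ext) (rule free_act_mult)

lemma free_act_relator:
  assumes "supersymmetric F"
  shows "free_act (gl_relator x y) F l = 0"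
proof -
  obtain a b c d where xy: "x = (a, b)" "y = (c, d)" by fastforce
  have "free_act (gl_bracket x y) F l = br x y (\<lambda>z. act z F l)"
    unfolding gl_bracket_def xy prod.case free_act_diff free_act_mult_fun free_act_const
      scal_koszul_sign br_def fst_conv snd_conv
    by (simp add: free_act_gen)
  then show ?thesis
    unfolding gl_relator_def free_act_diff free_act_mult_fun free_act_const free_act_gen
      scal_koszul_sign act_bracket[OF assms, of x y] by simp
qed

text \<open>A relator acts by zero on supersymmetric covectors by \<open>act_bracket\<close>, and
  the right factor v preserves supersymmetry. Hence the action descends to the quotient.\<close>

lemma free_act_ideal:
  assumes "supersymmetric F" "f \<in> gl_ideal"
  shows "free_act f F l = 0"
  using assms(2)
proof (induction arbitrary: l)
  case (relator u x y v)
  have "free_act (gl_relator x y) (free_act v F) = (\<lambda>l. 0)"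
    using free_act_relator[OF supersymmetric_free_act[OF assms(1)]] by blast
  then show ?case by (simp add: free_act_mult_fun)
qed (simp_all add: free_act_add)

lemma free_act_rep_abs:
  assumes "supersymmetric F"
  shows "free_act (rep_ugl (abs_ugl f)) F = free_act f F"
proof
  fix l
  have "gl_rel (rep_ugl (abs_ugl f)) f"
    using Quotient3_ugl Quotient3_def by (metis Quotient3_rep_abs equivp_reflp[OF equivp_gl_rel])
  then have "free_act (rep_ugl (abs_ugl f) - f) F l = 0"
    by (intro free_act_ideal[OF assms]) (simp add: gl_rel_def)
  then show "free_act (rep_ugl (abs_ugl f)) F l = free_act f F l"
    by (simp add: free_act_diff)
qed

text \<open>The representative is an arbitrary choice; on supersymmetric covectors the result does
  not depend on it.\<close>

definition ugl_act :: "('p, 'q, 'n) ugl \<Rightarrow> ('p, 'q, 'n) covec \<Rightarrow> ('p, 'q, 'n) covec" where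
  "ugl_act x = free_act (rep_ugl x)"

lemma ugl_act_abs: "supersymmetric F \<Longrightarrow> ugl_act (abs_ugl f) F = free_act f F"
  by (simp add: ugl_act_def free_act_rep_abs)

lemma supersymmetric_ugl_act: "supersymmetric F \<Longrightarrow> supersymmetric (ugl_act x F)"
  by (simp add: ugl_act_def supersymmetric_free_act)

lemma abs_ugl_surj: "\<exists>f. x = abs_ugl f"
  by (metis Quotient3_abs_rep[OF Quotient3_ugl])

lemma ugl_act_add:
  assumes "supersymmetric F"
  shows "ugl_act (x + y) F l = ugl_act x F l + ugl_act y F l"
proof -
  obtain f g where "x = abs_ugl f" "y = abs_ugl g" using abs_ugl_surj by metis
  then show ?thesis by (simp add: plus_ugl.abs_eq ugl_act_abs[OF assms] free_act_add)
qed

lemma ugl_act_mult: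
  assumes "supersymmetric F"
  shows "ugl_act (x * y) F = ugl_act x (ugl_act y F)"
proof -
  obtain f g where "x = abs_ugl f" "y = abs_ugl g" using abs_ugl_surj by metis
  then show ?thesis
    by (simp add: times_ugl.abs_eq ugl_act_abs assms supersymmetric_free_act free_act_mult_fun)
qed

lemma ugl_act_e: "supersymmetric F \<Longrightarrow> ugl_act (e a b) F = act (a, b) F"
  by (simp add: e.abs_eq ugl_act_abs free_act_gen)

lemma ugl_act_scal: "supersymmetric F \<Longrightarrow> ugl_act (scal c) F = (\<lambda>l. scal c * F l)"
  by (simp add: scal.abs_eq ugl_act_abs free_act_const)

lemma ugl_act_e_prod: "supersymmetric F \<Longrightarrow> ugl_act (e_prod w) F = foldr act w F"
proof (induction w)
  case Nil
  then show ?case using ugl_act_scal[of F 1] by (simp add: e_prod_def)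
next
  case (Cons x w)
  then show ?case
    by (cases x) (simp add: e_prod_def ugl_act_mult ugl_act_e supersymmetric_foldr_act)
qed

text \<open>At the empty list e_{i,j} acts through \<open>vac\<close>, that is, by left
  multiplication. F is arbitrary because a product x y applies the claim for x to the covector y
  F.\<close>

lemma ugl_act_Ugln: "x \<in> Ugln \<Longrightarrow> supersymmetric F \<Longrightarrow> ugl_act x F [] = x * F []"
proof (induction arbitrary: F rule: Ugln.induct)
  case (mult x y)
  then show ?case by (simp add: ugl_act_mult supersymmetric_ugl_act mult.assoc)
qed (simp_all add: ugl_act_scal ugl_act_e act_Nil ugl_act_add distrib_right)

lemma ugl_act_Irr: "x \<in> Irr \<Longrightarrow> ugl_act x vacuum l = 0"
proof (induction arbitrary: l rule: Irr.induct)
  case zero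
  show ?case using ugl_act_scal[OF supersymmetric_vacuum, of 0] by (metis mult_zero_left scal_0)
next
  case (mult w x)
  then show ?case
    by (simp add: ugl_act_mult ugl_act_e_prod supersymmetric_vacuum irregular_vacuum)
      (simp add: ugl_act_def)
qed (simp add: ugl_act_add supersymmetric_vacuum)

text \<open>Since \<open>Irr\<close> annihilates the vacuum, every admissible u is the component at
  the empty list of x applied to the vacuum. This gives the uniqueness behind
  \<open>THE\<close>.\<close>

lemma devirt_eq:
  assumes "u \<in> Ugln" "x - u \<in> Irr"
  shows "devirt x = u"
proof -
  have act: "ugl_act x vacuum [] = v" if "v \<in> Ugln" "x - v \<in> Irr" for v
    using ugl_act_add[OF supersymmetric_vacuum, of "x - v" v "[]"] ugl_act_Irr[OF that(2)]
      ugl_act_Ugln[OF that(1) supersymmetric_vacuum] by (simp add: vacuum_def)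
  show ?thesis
    unfolding devirt_def using assms act by (intro the_equality) auto
qed

section \<open>Calculus modulo irregular expressions\<close>

lemma e_prod_Nil [simp]: "e_prod [] = 1"
  by (simp add: e_prod_def)

lemma e_prod_Cons [simp]: "e_prod ((a, b) # w) = e a b * e_prod w"
  by (simp add: e_prod_def)

lemma e_prod_append [simp]: "e_prod (v @ w) = e_prod v * e_prod w"
  by (simp add: e_prod_def)

lemma Irr_mult_left: "x \<in> Irr \<Longrightarrow> y * x \<in> Irr"
proof (induction rule: Irr.induct)
  case (mult w x)
  then show ?case using Irr.mult[of w "y * x"] by (simp add: mult.assoc)
qed (auto intro: Irr.intros simp: distrib_left)

lemma Irr_uminus: "x \<in> Irr \<Longrightarrow> - x \<in> Irr"
  using Irr_mult_left[of x "- 1"] by simp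

lemma Irr_diff: "x \<in> Irr \<Longrightarrow> y \<in> Irr \<Longrightarrow> x - y \<in> Irr"
  using Irr.add[of x "- y"] Irr_uminus[of y] by simp

lemma Irr_trans: "x - y \<in> Irr \<Longrightarrow> y - z \<in> Irr \<Longrightarrow> x - z \<in> Irr"
  using Irr.add[of "x - y" "y - z"] by simp

lemma Irr_e_prod: "irregular w \<Longrightarrow> e_prod w \<in> Irr"
  using Irr.mult[of w 1] by simp

lemma irregular_Cons:
  assumes "is_virtual \<gamma>" "\<gamma> \<notin> fst ` set w"
  shows "irregular ((a, \<gamma>) # w)"
  unfolding irregular_iff
  using assms count_notin[of \<gamma> "map fst w"]
  by (intro exI[of _ "[]"] exI[of _ "(a, \<gamma>)"] exI[of _ w] exI[of _ \<gamma>]) simp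

text \<open>Proper units leave the counts of virtual symbols unchanged. This makes the left ideal
  \<open>Irr\<close> stable under right multiplication by \<open>Ugln\<close>.\<close>

lemma irregular_append_Prop:
  assumes "irregular w"
  shows "irregular (w @ [(Prop i, Prop j)])"
proof -
  obtain u x v \<gamma> where "w = u @ x # v" "is_virtual \<gamma>"
    "count_list (map fst v) \<gamma> < count_list (map snd (x # v)) \<gamma>"
    using assms unfolding irregular_iff by blast
  then have "w @ [(Prop i, Prop j)] = u @ x # (v @ [(Prop i, Prop j)])" "is_virtual \<gamma>"
    "count_list (map fst (v @ [(Prop i, Prop j)])) \<gamma>
      < count_list (map snd (x # v @ [(Prop i, Prop j)])) \<gamma>"
    by (cases \<gamma>; auto split: if_splits)+
  then show ?thesis
    unfolding irregular_iff by blast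
qed

lemma Irr_mult_Ugln: "u \<in> Ugln \<Longrightarrow> x \<in> Irr \<Longrightarrow> x * u \<in> Irr"
proof (induction arbitrary: x rule: Ugln.induct)
  case (scal c)
  then show ?case by (metis Irr_mult_left scal_central)
next
  case (e i j)
  then show ?case
  proof (induction rule: Irr.induct)
    case (mult w x)
    then show ?case
      using Irr.mult[OF irregular_append_Prop, of w x i j] by (simp add: mult.assoc)
  qed (auto intro: Irr.intros simp: distrib_right)
next
  case (add u v)
  then show ?case by (simp add: distrib_left Irr.add)
next
  case (mult u v)
  then show ?case by (simp add: mult.assoc[symmetric])
qed

lemma Ugln_uminus: "u \<in> Ugln \<Longrightarrow> - u \<in> Ugln"
  using Ugln.mult[OF Ugln.scal[of "- 1"], of u] by (simp add: scal_uminus)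

section \<open>Elimination of the positive virtual symbols\<close>

lemma e_anticommute_e_prod:
  assumes "odd (par a + par b)"
    and "\<And>c d. (c, d) \<in> set w \<Longrightarrow> odd (par c + par d) \<and> c \<noteq> b \<and> d \<noteq> a"
  shows "e a b * e_prod w = (- 1) ^ length w * (e_prod w * e a b)"
  using assms(2)
proof (induction w)
  case (Cons x w)
  obtain c d where x: "x = (c, d)" by fastforce
  have cd: "odd (par c + par d)" "c \<noteq> b" "d \<noteq> a"
    using Cons.prems[of c d] x by auto
  have "odd ((par a + par b) * (par c + par d))"
    using assms(1) cd(1) by simp
  then have "e a b * e c d = - (e c d * e a b)"
    using cd by (subst e_commutator) auto
  then have "e a b * e_prod (x # w) = - (e c d * (e a b * e_prod w))"
    by (simp add: x mult.assoc[symmetric])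
  also have "e a b * e_prod w = (- 1) ^ length w * (e_prod w * e a b)"
    using Cons by auto
  also have "e c d * ((- 1) ^ length w * (e_prod w * e a b)) =
      (- 1) ^ length w * (e c d * (e_prod w * e a b))"
    by (cases "even (length w)") simp_all
  finally show ?case by (simp add: x mult.assoc)
qed simp

text \<open>The exponent is k(k - 1)/2, so this is the sign of reversing k odd factors; as a sum it
  grows by the k exchanges of each induction step.\<close>

definition rev_sgn :: "nat \<Rightarrow> ('p, 'q, 'n) ugl" where
  "rev_sgn k = (- 1) ^ (\<Sum>t<k. t)"

lemma rev_sgn_cases: "rev_sgn k = 1 \<or> rev_sgn k = - 1"
  unfolding rev_sgn_def by (metis neg_one_even_power neg_one_odd_power)

text \<open>The last e_{a,\<alpha>} is moved right: it anticommutes with all e_{\<alpha>,c} of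
  smaller index, since the \<alpha>'s are distinct, and its commutator with its own partner is
  e_{a,c}. The term in which it passes the partner as well is irregular.\<close>

lemma eliminate_positive:
  fixes a c :: "nat \<Rightarrow> ('p, 'q, 'n) symb" and \<alpha> :: "nat \<Rightarrow> 'p"
  assumes "inj_on \<alpha> {..<k}"
    and "\<And>t. t < k \<Longrightarrow> par (a t) = 1 \<and> par (c t) = 1"
    and "\<And>s t. s < k \<Longrightarrow> t < k \<Longrightarrow> a s \<noteq> c t"
    and "\<And>p. Pos p \<notin> fst ` set w"
  shows "e_prod (map (\<lambda>t. (a t, Pos (\<alpha> t))) [0..<k]) * e_prod (map (\<lambda>t. (Pos (\<alpha> t), c t)) [0..<k])
      * e_prod w - rev_sgn k * (e_prod (map (\<lambda>t. (a t, c t)) [0..<k]) * e_prod w) \<in> Irr"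
  using assms
proof (induction k arbitrary: w)
  case 0
  show ?case by (simp add: rev_sgn_def Irr.zero)
next
  case (Suc k)
  let ?P = "e_prod (map (\<lambda>t. (a t, Pos (\<alpha> t))) [0..<k])"
  let ?Q = "e_prod (map (\<lambda>t. (Pos (\<alpha> t), c t)) [0..<k])"
  let ?R = "e_prod (map (\<lambda>t. (a t, c t)) [0..<k])"
  let ?a = "a k" and ?p = "Pos (\<alpha> k)" and ?c = "c k"
  have par: "par ?a = 1" "par ?c = 1" and ac: "?a \<noteq> ?c"
    using Suc.prems(2,3) by auto
  have comm: "e ?a ?p * ?Q = (- 1) ^ k * (?Q * e ?a ?p)"
  proof -
    define ps :: "('p, 'q, 'n) unit_symb list" where "ps = map (\<lambda>t. (Pos (\<alpha> t), c t)) [0..<k]"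
    have "e ?a ?p * e_prod ps = (- 1) ^ length ps * (e_prod ps * e ?a ?p)"
    proof (rule e_anticommute_e_prod)
      fix u v assume "(u, v) \<in> set ps"
      then obtain t where t: "t < k" "u = Pos (\<alpha> t)" "v = c t" by (auto simp: ps_def)
      with Suc.prems(1) have "\<alpha> t \<noteq> \<alpha> k" by (auto simp: inj_on_def)
      then show "odd (par u + par v) \<and> u \<noteq> ?p \<and> v \<noteq> ?a"
        using t Suc.prems(2)[of t] Suc.prems(3)[of k t] by auto
    qed (simp add: par)
    then show ?thesis by (simp add: ps_def)
  qed
  have ecomm: "e ?a ?p * e ?p ?c = e ?a ?c - e ?p ?c * e ?a ?p"
    using par ac by (subst e_commutator) auto
  have sgn: "rev_sgn (Suc k) = rev_sgn k * (- 1) ^ k"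
    by (simp add: rev_sgn_def power_add)
  have central: "x * ((- 1) ^ k * y) = (- 1) ^ k * (x * y)" for x y :: "('p, 'q, 'n) ugl"
    by (cases "even k") simp_all
  have "?P * e ?a ?p * (?Q * e ?p ?c) * e_prod w
      = ?P * (e ?a ?p * ?Q) * e ?p ?c * e_prod w"
    by (simp add: mult.assoc)
  also have "\<dots> = (- 1) ^ k * (?P * ?Q * (e ?a ?p * e ?p ?c) * e_prod w)"
    unfolding comm by (simp add: mult.assoc central)
  also have "\<dots> = (- 1) ^ k * (?P * ?Q * e_prod ((?a, ?c) # w))
      - (- 1) ^ k * (?P * ?Q * e ?p ?c * e_prod ((?a, ?p) # w))"
    unfolding ecomm by (simp add: algebra_simps)
  finally have expand: "?P * e ?a ?p * (?Q * e ?p ?c) * e_prod w = \<dots>" .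
  \<comment> \<open>Here the positive symbol is destroyed directly before w, in which no positive
    symbol is created.\<close>
  have irr: "(- 1) ^ k * (?P * ?Q * e ?p ?c * e_prod ((?a, ?p) # w)) \<in> Irr"
    using Suc.prems(4) by (intro Irr_mult_left Irr_e_prod irregular_Cons) auto
  \<comment> \<open>The new factor joins w; this is why w varies in the induction.\<close>
  have "?P * ?Q * e_prod ((?a, ?c) # w) - rev_sgn k * (?R * e_prod ((?a, ?c) # w)) \<in> Irr"
  proof (rule Suc.IH)
    show "inj_on \<alpha> {..<k}" using Suc.prems(1) by (auto simp: inj_on_def)
    show "Pos p \<notin> fst ` set ((?a, ?c) # w)" for p
      using Suc.prems(4) par(1) by (cases ?a) auto
  qed (use Suc.prems(2,3) in auto)
  then have "(- 1) ^ k * (?P * ?Q * e_prod ((?a, ?c) # w) - rev_sgn k * (?R * e_prod ((?a, ?c) # w))) \<in> Irr"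
    by (rule Irr_mult_left)
  note diff = Irr_diff[OF this irr]
  have lhs: "e_prod (map (\<lambda>t. (a t, Pos (\<alpha> t))) [0..<Suc k])
      * e_prod (map (\<lambda>t. (Pos (\<alpha> t), c t)) [0..<Suc k]) * e_prod w
      = ?P * e ?a ?p * (?Q * e ?p ?c) * e_prod w"
    by simp
  have rhs: "rev_sgn (Suc k) * (e_prod (map (\<lambda>t. (a t, c t)) [0..<Suc k]) * e_prod w)
      = (- 1) ^ k * (rev_sgn k * (?R * e_prod ((?a, ?c) # w)))"
    by (simp add: sgn mult.assoc central)
  show ?case
    unfolding lhs rhs expand using diff by (simp only: right_diff_distrib diff_diff_eq add.commute)
qed

section \<open>Independence of the negative virtual symbol\<close>

lemma Neg_Prop_commutators:
  "e (Prop i) (Prop j) * e (Neg \<beta>) (Prop l) =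
     e (Neg \<beta>) (Prop l) * e (Prop i) (Prop j) - (if i = l then e (Neg \<beta>) (Prop j) else 0)"
  "e (Neg \<beta>) (Neg \<beta>) * e (Neg \<beta>) (Prop l) =
     e (Neg \<beta>) (Prop l) * e (Neg \<beta>) (Neg \<beta>) + e (Neg \<beta>) (Prop l)"
  "e (Prop i) (Neg \<beta>) * e (Neg \<beta>) (Prop l) =
     e (Neg \<beta>) (Prop l) * e (Prop i) (Neg \<beta>) + e (Prop i) (Prop l)
     - (if i = l then e (Neg \<beta>) (Neg \<beta>) else 0)"
  by (subst e_commutator; simp)+

text \<open>The elements \<open>u\<close> do not depend on \<open>\<beta>\<close>; this is what makes the devirtualization independent of
  the choice of virtual symbols.\<close>

inductive uniform :: "nat \<Rightarrow> ('q \<Rightarrow> ('p, 'q, 'n) ugl) \<Rightarrow> bool" where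
  word: "length js = s \<Longrightarrow> u \<in> Ugln \<Longrightarrow> uniform s (\<lambda>\<beta>. e_prod (map (\<lambda>j. (Neg \<beta>, Prop j)) js) * u)"
| irr: "(\<And>\<beta>. F \<beta> \<in> Irr) \<Longrightarrow> uniform s F"
| add: "uniform s F \<Longrightarrow> uniform s G \<Longrightarrow> uniform s (\<lambda>\<beta>. F \<beta> + G \<beta>)"

text \<open>Irregular terms and sums survive left multiplication, so only the generating words need
  checking. The level s counts their factors e_{\<beta>,j}.\<close>

lemma uniform_mult_left:
  fixes F :: "'q \<Rightarrow> ('p, 'q, 'n) ugl"
  assumes "\<And>js u. length js = s \<Longrightarrow> u \<in> Ugln \<Longrightarrow>
      uniform r (\<lambda>\<beta>. y \<beta> * (e_prod (map (\<lambda>j. (Neg \<beta>, Prop j)) js) * u))"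
    and "uniform s F"
  shows "uniform r (\<lambda>\<beta>. y \<beta> * F \<beta>)"
  using assms(2,1)
proof (induction rule: uniform.induct)
  case (word js s u)
  then show ?case by blast
next
  case (irr F s)
  then show ?case by (simp add: Irr_mult_left uniform.irr)
next
  case (add s F G)
  then show ?case by (simp add: distrib_left uniform.add)
qed

lemma uniform_uminus: "uniform s F \<Longrightarrow> uniform s (\<lambda>\<beta>. - F \<beta>)"
proof (induction rule: uniform.induct)
  case (word js s u)
  then show ?case using uniform.word[OF word(1) Ugln_uminus[OF word(2)]] by simp
next
  case (irr F s)
  then show ?case by (simp add: Irr_uminus uniform.irr)
next
  case (add s F G)
  then show ?case using uniform.add[OF add.IH] by (simp add: add.commute)
qed

lemma uniform_diff: "uniform s F \<Longrightarrow> uniform s G \<Longrightarrow> uniform s (\<lambda>\<beta>. F \<beta> - G \<beta>)"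
  using uniform.add[of s F "\<lambda>\<beta>. - G \<beta>"] uniform_uminus[of s G] by simp

lemma uniform_zero: "uniform s (\<lambda>\<beta>. 0)"
  by (simp add: uniform.irr Irr.zero)

lemma uniform_Neg_Prop:
  fixes F :: "'q \<Rightarrow> ('p, 'q, 'n) ugl"
  assumes "uniform s F"
  shows "uniform (Suc s) (\<lambda>\<beta>. e (Neg \<beta>) (Prop j) * F \<beta>)"
proof (rule uniform_mult_left[OF _ assms])
  fix js :: "'n list" and u :: "('p, 'q, 'n) ugl"
  assume "length js = s" "u \<in> Ugln"
  then show "uniform (Suc s)
      (\<lambda>\<beta>. e (Neg \<beta>) (Prop j) * (e_prod (map (\<lambda>j. (Neg \<beta>, Prop j)) js) * u))"
    using uniform.word[of "j # js" "Suc s" u] by (simp add: mult.assoc)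
qed

text \<open>Moving e_{i,j} to the right replaces some e_{\<beta>,i} by e_{\<beta>,j}, which keeps
  the level; at the end e_{i,j} is absorbed into u.\<close>

lemma uniform_Prop_Prop:
  fixes F :: "'q \<Rightarrow> ('p, 'q, 'n) ugl"
  assumes "uniform s F"
  shows "uniform s (\<lambda>\<beta>. e (Prop i) (Prop j) * F \<beta>)"
proof (rule uniform_mult_left[OF _ assms])
  fix js :: "'n list" and u :: "('p, 'q, 'n) ugl"
  assume "length js = s" and u: "u \<in> Ugln"
  then show "uniform s (\<lambda>\<beta>. e (Prop i) (Prop j) * (e_prod (map (\<lambda>j. (Neg \<beta>, Prop j)) js) * u))"
  proof (induction js arbitrary: s)
    case Nil
    then show ?case using uniform.word[of "[]" s "e (Prop i) (Prop j) * u"] by (simp add: Ugln.intros)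
  next
    case (Cons l js)
    let ?m = "\<lambda>\<beta>. e_prod (map (\<lambda>j. (Neg \<beta>, Prop j)) js) * u"
    have "uniform s (\<lambda>\<beta>. e (Neg \<beta>) (Prop l) * (e (Prop i) (Prop j) * ?m \<beta>))"
      using uniform_Neg_Prop[OF Cons.IH[OF refl u]] Cons.prems(1) by auto
    moreover have "uniform s (\<lambda>\<beta>. if i = l then e (Neg \<beta>) (Prop j) * ?m \<beta> else 0)"
      using uniform_Neg_Prop[OF uniform.word[OF refl u, of js], of j] Cons.prems(1) uniform_zero
      by (cases "i = l") auto
    ultimately have "uniform s (\<lambda>\<beta>. e (Neg \<beta>) (Prop l) * (e (Prop i) (Prop j) * ?m \<beta>)
        - (if i = l then e (Neg \<beta>) (Prop j) * ?m \<beta> else 0))"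
      by (rule uniform_diff)
    moreover have "e (Prop i) (Prop j) * (e_prod (map (\<lambda>j. (Neg \<beta>, Prop j)) (l # js)) * u) =
      e (Neg \<beta>) (Prop l) * (e (Prop i) (Prop j) * ?m \<beta>)
        - (if i = l then e (Neg \<beta>) (Prop j) * ?m \<beta> else 0)" for \<beta>
      using arg_cong[OF Neg_Prop_commutators(1)[of i j \<beta> l], of "\<lambda>x. x * ?m \<beta>"]
      by (simp add: left_diff_distrib mult.assoc split: if_splits)
    ultimately show ?case by simp
  qed
qed

text \<open>Each passage of e_{\<beta>,\<beta>} reproduces the factor passed. In front of u it is
  irregular, and \<open>Irr_mult_Ugln\<close> disposes of u.\<close>

lemma uniform_Neg_Neg:
  fixes F :: "'q \<Rightarrow> ('p, 'q, 'n) ugl"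
  assumes "uniform s F"
  shows "uniform s (\<lambda>\<beta>. e (Neg \<beta>) (Neg \<beta>) * F \<beta>)"
proof (rule uniform_mult_left[OF _ assms])
  fix js :: "'n list" and u :: "('p, 'q, 'n) ugl"
  assume "length js = s" and u: "u \<in> Ugln"
  then show "uniform s (\<lambda>\<beta>. e (Neg \<beta>) (Neg \<beta>) * (e_prod (map (\<lambda>j. (Neg \<beta>, Prop j)) js) * u))"
  proof (induction js arbitrary: s)
    case Nil
    have "e_prod [(Neg \<beta>, Neg \<beta>)] * u \<in> Irr" for \<beta>
      by (intro Irr_mult_Ugln[OF u] Irr_e_prod irregular_Cons) auto
    then show ?case by (intro uniform.irr) simp
  next
    case (Cons l js)
    let ?m = "\<lambda>\<beta>. e_prod (map (\<lambda>j. (Neg \<beta>, Prop j)) js) * u"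
    have "uniform s (\<lambda>\<beta>. e (Neg \<beta>) (Prop l) * (e (Neg \<beta>) (Neg \<beta>) * ?m \<beta>) + e (Neg \<beta>) (Prop l) * ?m \<beta>)"
      using uniform.add[OF uniform_Neg_Prop[OF Cons.IH[OF refl u]]
        uniform_Neg_Prop[OF uniform.word[OF refl u]]] Cons.prems(1) by auto
    moreover have "e (Neg \<beta>) (Neg \<beta>) * (e_prod (map (\<lambda>j. (Neg \<beta>, Prop j)) (l # js)) * u) =
      e (Neg \<beta>) (Prop l) * (e (Neg \<beta>) (Neg \<beta>) * ?m \<beta>) + e (Neg \<beta>) (Prop l) * ?m \<beta>" for \<beta>
      using arg_cong[OF Neg_Prop_commutators(2)[of \<beta> l], of "\<lambda>x. x * ?m \<beta>"]
      by (simp add: distrib_right mult.assoc)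
    ultimately show ?case by simp
  qed
qed

text \<open>Moving e_{i,\<beta>} to the right either consumes a factor e_{\<beta>,l}, leaving units
  that keep the level, or passes every factor and becomes irregular. So the level drops by
  one.\<close>

lemma uniform_Prop_Neg:
  fixes F :: "'q \<Rightarrow> ('p, 'q, 'n) ugl"
  assumes "uniform (Suc s) F"
  shows "uniform s (\<lambda>\<beta>. e (Prop i) (Neg \<beta>) * F \<beta>)"
proof (rule uniform_mult_left[OF _ assms])
  fix js :: "'n list" and u :: "('p, 'q, 'n) ugl"
  assume "length js = Suc s" and u: "u \<in> Ugln"
  then show "uniform s (\<lambda>\<beta>. e (Prop i) (Neg \<beta>) * (e_prod (map (\<lambda>j. (Neg \<beta>, Prop j)) js) * u))"
  proof (induction js arbitrary: s)
    case (Cons l js)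
    let ?m = "\<lambda>\<beta>. e_prod (map (\<lambda>j. (Neg \<beta>, Prop j)) js) * u"
    have m: "uniform s ?m"
      using uniform.word[OF _ u, of js s] Cons.prems(1) by simp
    have "uniform s (\<lambda>\<beta>. e (Neg \<beta>) (Prop l) * (e (Prop i) (Neg \<beta>) * ?m \<beta>))"
    proof (cases s)
      \<comment> \<open>The induction hypothesis covers only nonempty lists; with none left,
        e_{i,\<beta>} stands directly before u.\<close>
      case 0
      then have "js = []" using Cons.prems(1) by simp
      moreover have "e_prod [(Prop i, Neg \<beta>)] * u \<in> Irr" for \<beta>
        by (intro Irr_mult_Ugln[OF u] Irr_e_prod irregular_Cons) auto
      ultimately have "e (Prop i) (Neg \<beta>) * ?m \<beta> \<in> Irr" for \<beta>
        by simp
      then show ?thesis by (rule uniform.irr[OF Irr_mult_left])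
    next
      case (Suc r)
      then show ?thesis using uniform_Neg_Prop[OF Cons.IH[of r, OF _ u]] Cons.prems(1) by simp
    qed
    moreover have "uniform s (\<lambda>\<beta>. if i = l then e (Neg \<beta>) (Neg \<beta>) * ?m \<beta> else 0)"
      using uniform_Neg_Neg[OF m] uniform_zero by (cases "i = l") auto
    ultimately have "uniform s (\<lambda>\<beta>. e (Neg \<beta>) (Prop l) * (e (Prop i) (Neg \<beta>) * ?m \<beta>)
        + e (Prop i) (Prop l) * ?m \<beta> - (if i = l then e (Neg \<beta>) (Neg \<beta>) * ?m \<beta> else 0))"
      by (intro uniform_diff uniform.add uniform_Prop_Prop m)
    moreover have "e (Prop i) (Neg \<beta>) * (e_prod (map (\<lambda>j. (Neg \<beta>, Prop j)) (l # js)) * u) =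
        e (Neg \<beta>) (Prop l) * (e (Prop i) (Neg \<beta>) * ?m \<beta>)
        + e (Prop i) (Prop l) * ?m \<beta> - (if i = l then e (Neg \<beta>) (Neg \<beta>) * ?m \<beta> else 0)" for \<beta>
      using arg_cong[OF Neg_Prop_commutators(3)[of i \<beta> l], of "\<lambda>x. x * ?m \<beta>"]
      by (simp add: left_diff_distrib distrib_right mult.assoc split: if_splits)
    ultimately show ?case by simp
  qed simp
qed

definition polarized :: "'q \<Rightarrow> 'n list \<Rightarrow> 'n list \<Rightarrow> ('p, 'q, 'n) ugl" where
  "polarized \<beta> xs ys = e_prod (map (\<lambda>i. (Prop i, Neg \<beta>)) xs) * e_prod (map (\<lambda>j. (Neg \<beta>, Prop j)) ys)"

text \<open>Each e_{i,\<beta>} on the left uses up one e_{\<beta>,j}; s is the surplus of the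
  latter.\<close>

lemma uniform_polarized:
  "uniform s (\<lambda>\<beta>. polarized \<beta> xs ys)" if "length ys = length xs + s"
  using that
proof (induction xs arbitrary: s)
  case Nil
  then show ?case using uniform.word[of ys s "scal 1"] Ugln.scal[of 1] by (simp add: polarized_def)
next
  case (Cons i xs)
  then show ?case
    using uniform_Prop_Neg[of s "\<lambda>\<beta>. polarized \<beta> xs ys" i] by (simp add: polarized_def mult.assoc)
qed

text \<open>At level 0 the generating words contain no \<beta>, so a single u serves all
  \<beta>.\<close>

lemma uniform_0: "uniform s F \<Longrightarrow> s = 0 \<Longrightarrow> \<exists>u\<in>Ugln. \<forall>\<beta>. F \<beta> - u \<in> Irr"
proof (induction rule: uniform.induct)
  case (word ys s u)
  then show ?case by (intro bexI[of _ u]) (simp_all add: Irr.zero)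
next
  case (irr F s)
  then show ?case using Ugln.scal[of 0] by (intro bexI[of _ "scal 0"]) simp_all
next
  case (add s F G)
  then obtain u v where "u \<in> Ugln" "v \<in> Ugln" "\<And>\<beta>. F \<beta> - u \<in> Irr" "\<And>\<beta>. G \<beta> - v \<in> Irr" by blast
  then show ?case using Irr.add[of "F _ - u" "G _ - v"]
    by (intro bexI[of _ "u + v"]) (auto simp: Ugln.add algebra_simps)
qed

lemma devirt_polarized:
  fixes xs ys :: "'n list"
  assumes "length xs = length ys"
  obtains u :: "('p, 'q, 'n) ugl" where "\<And>\<beta> x. x - polarized \<beta> xs ys \<in> Irr \<Longrightarrow> devirt x = u"
proof -
  obtain u :: "('p, 'q, 'n) ugl" where "u \<in> Ugln" "\<And>\<beta>. polarized \<beta> xs ys - u \<in> Irr"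
    using uniform_0[OF uniform_polarized[of ys xs 0]] assms by auto
  then show ?thesis using that devirt_eq Irr_trans by metis
qed

section \<open>Schur and Nazarov elements\<close>

lemma prod_list_map_permute:
  fixes f :: "'a \<Rightarrow> 'b :: monoid_mult"
  assumes "\<And>x y. f x * f y = f y * f x" and "mset xs = mset ys"
  shows "prod_list (map f xs) = prod_list (map f ys)"
  using assms(2)
proof (induction xs arbitrary: ys)
  case (Cons x xs)
  then have "x \<in> set ys" by (metis list.set_intros(1) set_mset_mset)
  then obtain us vs where ys: "ys = us @ x # vs" by (metis split_list)
  have comm: "f x * prod_list (map f us) = prod_list (map f us) * f x"
  proof (induction us)
    case (Cons u us)
    have "f x * (f u * prod_list (map f us)) = f u * (f x * prod_list (map f us))"
      by (metis assms(1) mult.assoc)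
    then show ?case using Cons by (simp add: mult.assoc)
  qed simp
  have "prod_list (map f xs) = prod_list (map f (us @ vs))"
    using Cons.prems ys by (intro Cons.IH) simp
  then show ?case using comm by (simp add: ys mult.assoc[symmetric])
qed simp

lemma prod_list_map_power:
  "prod_list (map (\<lambda>i. f i ^ h i) xs) = prod_list (map f (concat (map (\<lambda>i. replicate (h i) i) xs)))"
  by (induction xs) simp_all

text \<open>Proper and negative symbols are both odd, so the units in each half are even, and within
  a half their brackets vanish.\<close>

lemma polarized_permute:
  assumes "mset xs = mset xs'" "mset ys = mset ys'"
  shows "polarized \<beta> xs ys = polarized \<beta> xs' ys'"
proof -
  have e_prod_map: "e_prod (map (\<lambda>i. (g i, h i)) zs) = prod_list (map (\<lambda>i. e (g i) (h i)) zs)"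
    for g h and zs :: "'a list"
    by (simp add: e_prod_def comp_def)
  have "e (Prop i) (Neg \<beta>) * e (Prop j) (Neg \<beta>) = e (Prop j) (Neg \<beta>) * e (Prop i) (Neg \<beta>)"
    "e (Neg \<beta>) (Prop i) * e (Neg \<beta>) (Prop j) = e (Neg \<beta>) (Prop j) * e (Neg \<beta>) (Prop i)" for i j
    by (subst e_commutator, simp)+
  then show ?thesis
    unfolding polarized_def e_prod_map using assms
    by (metis (no_types, lifting) prod_list_map_permute)
qed

section \<open>Tableaux of column shape\<close>

lemma conj_part_row: "k > 0 \<Longrightarrow> conj_part [k] = replicate k 1"
  by (auto simp: conj_part_def simp del: upt_Suc intro!: nth_equalityI)

lemma conj_part_column: "k > 0 \<Longrightarrow> conj_part (replicate k 1) = [k]"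
  by (cases k) (simp_all add: conj_part_def)

text \<open>In a column the arms are empty and row i, counted from 0, has leg k - i - 1, hence hook
  length k - i.\<close>

lemma hook_prod_column: "k > 0 \<Longrightarrow> hook_prod (replicate k 1) = fact k"
proof -
  assume k: "k > 0"
  have "hook_prod (replicate k 1) = (\<Prod>i<k. k - i)"
    unfolding hook_prod_def by (auto simp: hook_length_def conj_part_column[OF k, simplified] intro!: prod.cong)
  also have "\<dots> = fact k"
    by (simp add: fact_prod_rev atLeast0LessThan)
  finally show ?thesis .
qed

text \<open>Rows with one box are strictly increasing automatically, so the tableaux are just words
  of length k.\<close>

lemma has_shape_column:
  "{S. has_shape S (replicate k 1) \<and> (\<forall>row\<in>set S. sorted_wrt (<) row)}
    = map (\<lambda>i. [i]) ` {xs :: 'n :: linorder list. length xs = k}"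
proof (intro set_eqI iffI)
  fix S :: "'n list list"
  assume S: "S \<in> {S. has_shape S (replicate k 1) \<and> (\<forall>row\<in>set S. sorted_wrt (<) row)}"
  then have "length S = k" by (auto simp: has_shape_def dest: arg_cong[of _ _ length])
  moreover have "length row = 1" if "row \<in> set S" for row
  proof -
    have "length row \<in> set (map length S)" using that by simp
    moreover have "map length S = replicate k 1" using S by (simp add: has_shape_def)
    ultimately show ?thesis by (simp split: if_splits)
  qed
  then have "map (\<lambda>i. [i]) (map hd S) = S"
    unfolding map_map comp_def
    by (intro map_idI) (metis One_nat_def length_0_conv length_Suc_conv list.sel(1))
  ultimately show "S \<in> map (\<lambda>i. [i]) ` {xs. length xs = k}"
    by (metis (mono_tags, lifting) imageI length_map mem_Collect_eq)
next
  fix S :: "'n list list"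
  assume "S \<in> map (\<lambda>i. [i]) ` {xs. length xs = k}"
  then show "S \<in> {S. has_shape S (replicate k 1) \<and> (\<forall>row\<in>set S. sorted_wrt (<) row)}"
    by (auto simp: has_shape_def comp_def map_replicate_const)
qed

text \<open>The positive symbols are eliminated from the right pair of factors and then from the
  left pair. Each elimination contributes \<open>rev_sgn k\<close>, and the square of this sign is
  1.\<close>

lemma double_young_capelli_column:
  fixes \<alpha> :: "nat \<Rightarrow> 'p" and xs :: "'n list"
  assumes "inj_on \<alpha> {1..length xs}"
  shows "e_tab (map (map Prop) (map (\<lambda>i. [i]) xs)) (C_star \<alpha> (replicate (length xs) 1))
       * e_tab (C_star \<alpha> (replicate (length xs) 1)) (D_star \<beta> (replicate (length xs) 1))
       * e_tab (D_star \<beta> (replicate (length xs) 1)) (C_star \<alpha> (replicate (length xs) 1))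
       * e_tab (C_star \<alpha> (replicate (length xs) 1)) (map (map Prop) (map (\<lambda>i. [i]) xs))
     - (polarized (\<beta> 1) xs xs :: ('p, 'q, 'n) ugl) \<in> Irr"
proof -
  define k where "k = length xs"
  define p where "p t = (Prop (xs ! t) :: ('p, 'q, 'n) symb)" for t
  define b where "b t = (Neg (\<beta> 1) :: ('p, 'q, 'n) symb)" for t :: nat
  define a where "a t = \<alpha> (Suc t)" for t
  have inj: "inj_on a {..<k}"
    using inj_onD[OF assms, of "Suc _" "Suc _"] by (intro inj_onI) (simp add: a_def k_def)
  have S: "concat (map (map Prop) (map (\<lambda>i. [i]) xs)) = map p [0..<k]"
    by (auto simp: p_def k_def comp_def concat_map_singleton intro!: nth_equalityI)
  have C: "concat (C_star \<alpha> (replicate k 1) :: ('p, 'q, 'n) symb tableau) = map (\<lambda>t. Pos (a t)) [0..<k]"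
  proof -
    have "(C_star \<alpha> (replicate k 1) :: ('p, 'q, 'n) symb tableau) = map (\<lambda>t. [Pos (a t)]) [0..<k]"
      by (auto simp: C_star_def a_def)
    then show ?thesis by (simp add: concat_map_singleton)
  qed
  \<comment> \<open>All rows have length one, so only the first negative symbol occurs.\<close>
  have D: "concat (D_star \<beta> (replicate k 1)) = map b [0..<k]"
    by (simp add: D_star_def b_def map_replicate_const concat_replicate_trivial)
      (auto simp: b_def intro!: nth_equalityI)
  have polarized: "polarized (\<beta> 1) xs xs = e_prod (map (\<lambda>t. (p t, b t)) [0..<k]) * e_prod (map (\<lambda>t. (b t, p t)) [0..<k])"
  proof -
    have eq: "map f xs = map (\<lambda>t. f (xs ! t)) [0..<k]" for f :: "'n \<Rightarrow> ('p, 'q, 'n) unit_symb"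
      by (rule nth_equalityI) (simp_all add: k_def)
    show ?thesis unfolding polarized_def p_def b_def eq ..
  qed
  let ?PC = "e_prod (map (\<lambda>t. (p t, Pos (a t))) [0..<k])"
  let ?CD = "e_prod (map (\<lambda>t. (Pos (a t), b t)) [0..<k])"
  let ?DC = "e_prod (map (\<lambda>t. (b t, Pos (a t))) [0..<k])"
  let ?CP = "e_prod (map (\<lambda>t. (Pos (a t), p t)) [0..<k])"
  let ?PD = "e_prod (map (\<lambda>t. (p t, b t)) [0..<k])"
  let ?DP = "e_prod (map (\<lambda>t. (b t, p t)) [0..<k])"
  let ?s = "rev_sgn k :: ('p, 'q, 'n) ugl"
  have "?DC * ?CP * e_prod [] - ?s * (?DP * e_prod []) \<in> Irr"
    by (rule eliminate_positive[OF inj]) (auto simp: p_def b_def)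
  then have right: "?PC * ?CD * (?DC * ?CP) - ?PC * ?CD * (?s * ?DP) \<in> Irr"
    using Irr_mult_left[of "?DC * ?CP - ?s * ?DP" "?PC * ?CD"] by (simp add: right_diff_distrib)
  \<comment> \<open>Now \<open>?DP\<close> is the trailing word; its first indices are negative, so
    it creates no positive symbol.\<close>
  have "?PC * ?CD * ?DP - ?s * (?PD * ?DP) \<in> Irr"
    by (rule eliminate_positive[OF inj]) (auto simp: p_def b_def)
  then have "?s * (?PC * ?CD * ?DP - ?s * (?PD * ?DP)) \<in> Irr"
    by (rule Irr_mult_left)
  moreover have "?s = 1 \<or> ?s = - 1" by (rule rev_sgn_cases)
  ultimately have left: "?PC * ?CD * (?s * ?DP) - ?PD * ?DP \<in> Irr"
    by (elim disjE) simp_all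
  have zip: "zip (map f [0..<k]) (map g [0..<k]) = map (\<lambda>t. (f t, g t)) [0..<k]" for f g :: "nat \<Rightarrow> ('p, 'q, 'n) symb"
    by (simp add: zip_map_map zip_same_conv_map)
  show ?thesis
    unfolding e_tab_def k_def[symmetric] S C D zip polarized
    using Irr_trans[OF right left] by (simp add: mult.assoc)
qed

lemma devirt_polarized_cong:
  assumes "x - polarized \<beta> xs ys \<in> Irr" "x' - polarized \<beta>' xs ys \<in> Irr" "length xs = length ys"
  shows "devirt x = devirt x'"
  using devirt_polarized[OF assms(3)] assms(1,2) by metis

section \<open>Words of given content\<close>

definition word_of :: "('n :: {finite, linorder} \<Rightarrow> nat) \<Rightarrow> 'n list" where
  "word_of h = concat (map (\<lambda>i. replicate (h i) i) (sorted_list_of_set UNIV))"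

lemma count_concat_replicate:
  "distinct xs \<Longrightarrow> count (mset (concat (map (\<lambda>i. replicate (h i) i) xs))) j = (if j \<in> set xs then h j else 0)"
  by (induction xs) auto

lemma count_word_of [simp]: "count (mset (word_of h)) = h"
  by (rule ext) (simp add: word_of_def count_concat_replicate)

lemma length_word_of [simp]: "length (word_of h) = (\<Sum>i\<in>UNIV. h i)"
  by (simp add: word_of_def length_concat comp_def sum_list_distinct_conv_sum_set)

text \<open>The left half comes in decreasing order of the proper symbols; as its factors commute,
  it may be put in increasing order.\<close>

lemma nazarov_word:
  fixes h :: "'n :: {finite, linorder} \<Rightarrow> nat"
  shows "prod_list (map (\<lambda>i. e (Prop i) (Neg \<beta>) ^ h i) (rev (sorted_list_of_set (UNIV :: 'n set))))
       * prod_list (map (\<lambda>i. e (Neg \<beta>) (Prop i) ^ h i) (sorted_list_of_set (UNIV :: 'n set)))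
     = (polarized \<beta> (word_of h) (word_of h) :: ('p, 'q, 'n) ugl)"
proof -
  let ?rev = "concat (map (\<lambda>i. replicate (h i) i) (rev (sorted_list_of_set UNIV)))"
  have "mset ?rev = mset (word_of h)"
    by (simp add: word_of_def mset_concat flip: rev_map)
  then have "polarized \<beta> ?rev (word_of h) = (polarized \<beta> (word_of h) (word_of h) :: ('p, 'q, 'n) ugl)"
    by (rule polarized_permute) simp
  then show ?thesis
    by (simp only: prod_list_map_power polarized_def e_prod_def word_of_def map_map comp_def prod.case)
qed

text \<open>This is the multinomial coefficient, obtained by counting the permutations of a
  multiset.\<close>

lemma card_content:
  fixes h :: "'n :: {finite, linorder} \<Rightarrow> nat"
  shows "card {xs. mset xs = mset (word_of h)} * (\<Prod>i\<in>UNIV. fact (h i)) = (fact (\<Sum>i\<in>UNIV. h i) :: nat)"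
proof -
  let ?M = "mset (word_of h)"
  \<comment> \<open>Symbols outside the multiset contribute 0! = 1.\<close>
  have "(\<Prod>i\<in>UNIV. fact (h i) :: nat) = (\<Prod>i\<in>set_mset ?M. fact (count ?M i))"
    unfolding count_word_of
    by (intro prod.mono_neutral_right) (auto simp del: set_mset_mset simp: not_in_iff)
  moreover have "size ?M = (\<Sum>i\<in>UNIV. h i)" by simp
  ultimately show ?thesis
    using card_permutations_of_multiset[of ?M] unfolding permutations_of_multiset_def
    by (metis dvd_div_mult_self)
qed

theorem proposition4p21:
  fixes k :: nat
    and \<alpha> :: "nat \<Rightarrow> 'p :: finite"
    and \<beta> :: "nat \<Rightarrow> 'q :: finite"
    and \<beta>' :: 'q
  assumes "k > 0"
    and "distinct_symbols (conj_part [k]) \<alpha> \<beta>"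
  shows "(nazarov_elt \<beta>' k :: ('p, 'q, 'n :: {finite, linorder}) ugl) = schur_elt \<alpha> \<beta> [k]"
proof -
  have inj: "inj_on \<alpha> {1..k}"
    using assms by (simp add: distinct_symbols_def conj_part_row)
  define d :: "'n list \<Rightarrow> ('p, 'q, 'n) ugl" where "d xs = devirt (polarized \<beta>' xs xs)" for xs
  let ?W = "{xs :: 'n list. length xs = k}"
  let ?content = "\<lambda>xs :: 'n list. count (mset xs)"
  have fin: "finite ?W"
    using finite_lists_length_eq[of "UNIV :: 'n set" k] by simp
  have d_perm: "d xs = d (word_of h)" if "mset xs = mset (word_of h)" for xs h
    unfolding d_def using polarized_permute[OF that that] by metis
  \<comment> \<open>The symbols \<open>\<beta> 1\<close> and \<open>\<beta>'\<close> may differ; the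
    devirtualized value is the same for both.\<close>
  have young: "double_young_capelli \<alpha> \<beta> (replicate k 1) (map (\<lambda>i. [i]) xs) (map (\<lambda>i. [i]) xs) = d xs"
    if "length xs = k" for xs
    unfolding d_def double_young_capelli_def
    using double_young_capelli_column[of \<alpha> xs \<beta>] inj that
    by (intro devirt_polarized_cong[of _ "\<beta> 1" xs xs _ \<beta>']) (simp_all add: Irr.zero)
  have image: "?content ` ?W = {h. (\<Sum>i\<in>UNIV. h i) = k}"
  proof (intro equalityI subsetI)
    fix h assume "h \<in> ?content ` ?W"
    then obtain xs where xs: "length xs = k" "h = ?content xs" by blast
    then have "mset (word_of h) = mset xs" by (intro multiset_eqI) simp
    then have "length (word_of h) = k" using xs(1) by (metis size_mset)
    then show "h \<in> {h. (\<Sum>i\<in>UNIV. h i) = k}" by simp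
  next
    fix h :: "'n \<Rightarrow> nat" assume "h \<in> {h. (\<Sum>i\<in>UNIV. h i) = k}"
    then show "h \<in> ?content ` ?W" by (intro image_eqI[of _ _ "word_of h"]) auto
  qed
  \<comment> \<open>All words of one content have the same value, and their number divided by k! is
    the coefficient in the Nazarov element.\<close>
  have fiber: "scal (1 / of_nat (fact k)) * (\<Sum>xs | xs \<in> ?W \<and> ?content xs = h. d xs)
      = scal (1 / of_nat (\<Prod>i\<in>UNIV. fact (h i))) * d (word_of h)"
    if "(\<Sum>i\<in>UNIV. h i) = k" for h
  proof -
    have eq: "{xs. xs \<in> ?W \<and> ?content xs = h} = {xs. mset xs = mset (word_of h)}"
      using that by (auto intro: multiset_eqI dest: arg_cong[of _ _ size])
    have "(\<Sum>xs | xs \<in> ?W \<and> ?content xs = h. d xs) = (\<Sum>xs | mset xs = mset (word_of h). d (word_of h))"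
      unfolding eq by (intro sum.cong refl d_perm) simp
    also have "\<dots> = scal (of_nat (card {xs. mset xs = mset (word_of h)})) * d (word_of h)"
      by (simp add: scal_of_nat)
    finally have "scal (1 / of_nat (fact k)) * (\<Sum>xs | xs \<in> ?W \<and> ?content xs = h. d xs)
      = scal (1 / of_nat (fact k) * of_nat (card {xs. mset xs = mset (word_of h)})) * d (word_of h)"
      by (simp only: scal_mult mult.assoc)
    moreover have "1 / of_nat (fact k) * of_nat (card {xs. mset xs = mset (word_of h)})
        = (1 / of_nat (\<Prod>i\<in>UNIV. fact (h i)) :: complex)"
    proof -
      have "1 / c * x = 1 / y" if "x * y = c" "c \<noteq> 0" for x y c :: complex
        using that by (auto simp: field_simps)
      moreover have "of_nat (card {xs. mset xs = mset (word_of h)}) * of_nat (\<Prod>i\<in>UNIV. fact (h i))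
          = (of_nat (fact k) :: complex)"
        using card_content[of h] that unfolding of_nat_mult[symmetric] by simp
      moreover have "of_nat (fact k) \<noteq> (0 :: complex)" by simp
      ultimately show ?thesis by blast
    qed
    ultimately show ?thesis by simp
  qed
  have "nazarov_elt \<beta>' k = (\<Sum>h | (\<Sum>i\<in>UNIV. h i) = k.
      scal (1 / of_nat (\<Prod>i\<in>UNIV. fact (h i))) * d (word_of h))"
    by (simp only: nazarov_elt_def nazarov_word d_def)
  also have "\<dots> = (\<Sum>h | (\<Sum>i\<in>UNIV. h i) = k.
      scal (1 / of_nat (fact k)) * (\<Sum>xs | xs \<in> ?W \<and> ?content xs = h. d xs))"
    by (intro sum.cong refl fiber[symmetric]) simp
  \<comment> \<open>The contents h index the fibres of the content map on words of length k, so the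
    double sum runs once over all words.\<close>
  also have "\<dots> = scal (1 / of_nat (fact k)) * (\<Sum>xs\<in>?W. d xs)"
    unfolding sum_distrib_left[symmetric] image[symmetric]
    by (subst sum.group[OF fin]) (use fin in auto)
  also have "(\<Sum>xs\<in>?W. d xs) =
      (\<Sum>S\<in>map (\<lambda>i. [i]) ` ?W. double_young_capelli \<alpha> \<beta> (replicate k 1) S S)"
    using young by (subst sum.reindex) (auto simp: inj_on_def)
  also have "scal (1 / of_nat (fact k)) * \<dots> = schur_elt \<alpha> \<beta> [k]"
    unfolding schur_elt_def conj_part_row[OF assms(1)] hook_prod_column[OF assms(1)] has_shape_column ..
  finally show ?thesis .
qed

end
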